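(* Let $M$ be a hypersurface in a semi-Riemannian space of constant curvature $N_{s}^{n+1}(c)$, $n\geq 4$, whose second fundamental tensor $H$ satisfies $$H^{3} = \mathrm{tr}(H)\,H^{2} + \psi\, H + \rho\, g$$ on $\mathcal{U}_{H}\subset M$, for some functions $\psi$ and $\rho$ on $\mathcal{U}_{H}$. Then $$(n-2)\,(R\cdot C - C\cdot R) = Q(S,R) + \Big(\frac{(n-1)\widetilde{\kappa}}{n(n+1)} - \frac{\kappa}{n-1} - \varepsilon\psi\Big)Q(g,R) + Q(S^{2},G) + \Big(\varepsilon\psi - \frac{2(n-1)\widetilde{\kappa}}{n(n+1)}\Big)Q(S,G)$$ on $\mathcal{U}_{H}$.
   Context: All manifolds are connected, paracompact and of class $C^{\infty}$. $N_s^{n+1}(c)$ is a semi-Riemannian space of constant curvature $c = \frac{\widetilde{\kappa}}{n(n+1)}$ with signature $(s,n+1-s)$, where $\widetilde{\kappa}$ is its scalar curvature. $M$ is a connected hypersurface isometrically immersed in $N_s^{n+1}(c)$, $\dim M=n$, with (non-degenerate) induced metric $g$ and second fundamental tensor $H$ (a symmetric $(0,2)$-tensor). In local components, $H^2_{ij} = H_{ir}g^{rs}H_{sj}$, $H^3_{ij} = H^2_{ir}g^{rs}H_{sj}$, $\mathrm{tr}(H) = g^{rs}H_{rs}$. The number $\varepsilon = \pm 1$ is the one appearing in the Gauss equation of $M$, $$R_{hijk} = \varepsilon\,(H_{hk}H_{ij} - H_{hj}H_{ik}) + \frac{\widetilde{\kappa}}{n(n+1)}\,G_{hijk}.$$ $\mathcal{U}_H$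 is the set of all points of $M$ at which $H^2$ is not a linear combination of $g$ and $H$. For $(M,g)$ with Levi-Civita connection $\nabla$ put $\mathcal{R}(X,Y)Z = \nabla_X\nabla_Y Z - \nabla_Y\nabla_X Z - \nabla_{[X,Y]}Z$. The Ricci tensor is $S(X,Y) = \mathrm{tr}\{Z \mapsto \mathcal{R}(Z,X)Y\}$, the Ricci operator $\mathcal{S}$ is given by $g(\mathcal{S}X,Y) = S(X,Y)$, $\kappa = \mathrm{tr}\,\mathcal{S}$ is the scalar curvature of $M$, and $S^{2}(X,Y) = S(\mathcal{S}X,Y)$. For a symmetric $(0,2)$-tensor $A$ define $(X\wedge_A Y)Z = A(Y,Z)X - A(X,Z)Y$. The Weyl endomorphism is $$\mathcal{C}(X,Y)Z = \mathcal{R}(X,Y)Z - \frac{1}{n-2}\Big(X\wedge_g \mathcal{S}Y + \mathcal{S}X\wedge_g Y - \frac{\kappa}{n-1}X\wedge_g Y\Big)Z.$$ The $(0,4)$-tensors $G$, $R$, $C$ are $G(X_1,X_2,X_3,X_4) = g((X_1\wedge_g X_2)X_3,X_4)$ (so $G_{hijk} = g_{hk}g_{ij} - g_{hj}g_{ik}$), $R(X_1,X_2,X_3,X_4) = g(\mathcal{R}(X_1,X_2)X_3,X_4)$ and $C(X_1,X_2,X_3,X_4) = g(\mathcal{C}(X_1,X_2)X_3,X_4)$. For $B\in\{R,C\}$ with corresponding endomorphism $\mathcal{B}\in\{\mathcal{R},\mathcal{C}\}$, a $(0,4)$-tensor $T$ and a symmetric $(0,2)$-tensor $A$, the $(0,6)$-tensors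 $B\cdot T$ and $Q(A,T)$ are $$(B\cdot T)(X_1,\ldots,X_4,X,Y) = -T(\mathcal{B}(X,Y)X_1,X_2,X_3,X_4) - \cdots - T(X_1,X_2,X_3,\mathcal{B}(X,Y)X_4),$$ $$Q(A,T)(X_1,\ldots,X_4,X,Y) = -T((X\wedge_A Y)X_1,X_2,X_3,X_4) - \cdots - T(X_1,X_2,X_3,(X\wedge_A Y)X_4).$$ *)

theory Defs
  imports "HOL-Analysis.Analysis"
begin

section \<open>Smooth maps between open subsets of Euclidean spaces\<close>

fun ck_on :: "nat \<Rightarrow> ('a::euclidean_space \<Rightarrow> 'b::real_normed_vector) \<Rightarrow> 'a set \<Rightarrow> bool" where
  "ck_on 0 f S \<longleftrightarrow> continuous_on S f"
| "ck_on (Suc k) f S \<longleftrightarrow> (\<forall>x\<in>S. f differentiable (at x)) \<and>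
     (\<forall>v. ck_on k (\<lambda>x. frechet_derivative f (at x) v) S)"

text \<open>Meant for open \<open>S\<close> only.\<close>

definition smooth_on :: "('a::euclidean_space \<Rightarrow> 'b::real_normed_vector) \<Rightarrow> 'a set \<Rightarrow> bool" where
  "smooth_on f S \<longleftrightarrow> (\<forall>k. ck_on k f S)"


section \<open>Semi-Riemannian geometry in one coordinate domain\<close>

text \<open>A symmetric (0,2)-tensor is stored as the matrix of its components, a metric on a
  coordinate domain as a matrix-valued function \<open>g\<close> of the coordinates, and a vector field
  as the function giving its components.\<close>

definition bform :: "real^'n^'n \<Rightarrow> real^'n \<Rightarrow> real^'n \<Rightarrow> real" where
  "bform A X Y = X \<bullet> (A *v Y)"

text \<open>\<open>metric_deriv g x V X Y\<close> is \<open>V\<close> applied to the function \<open>g(X, Y)\<close> for constant-component \<open>X, Y\<close>.\<close>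

definition metric_deriv ::
    "(real^'n \<Rightarrow> real^'n^'n) \<Rightarrow> real^'n \<Rightarrow> real^'n \<Rightarrow> real^'n \<Rightarrow> real^'n \<Rightarrow> real" where
  "metric_deriv g x V X Y = frechet_derivative (\<lambda>z. bform (g z) X Y) (at x) V"

text \<open>The vector with components \<open>\<Gamma>\<^sup>l\<^sub>i\<^sub>j X\<^sup>i Y\<^sup>j\<close>, i.e. the Levi-Civita derivative of \<open>Y\<close> along \<open>X\<close> for
  constant-component fields as given by the Koszul formula.\<close>

definition christoffel :: "(real^'n \<Rightarrow> real^'n^'n) \<Rightarrow> real^'n \<Rightarrow> real^'n \<Rightarrow> real^'n \<Rightarrow> real^'n" where
  "christoffel g x X Y = matrix_inv (g x) *v
     (\<chi> l. (metric_deriv g x X Y (axis l 1) + metric_deriv g x Y X (axis l 1)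
            - metric_deriv g x (axis l 1) X Y) / 2)"

definition covd :: "(real^'n \<Rightarrow> real^'n^'n) \<Rightarrow> (real^'n \<Rightarrow> real^'n) \<Rightarrow> (real^'n \<Rightarrow> real^'n) \<Rightarrow>
    real^'n \<Rightarrow> real^'n" where
  "covd g X Y x = frechet_derivative Y (at x) (X x) + christoffel g x (X x) (Y x)"

definition lie_bracket :: "(real^'n \<Rightarrow> real^'n) \<Rightarrow> (real^'n \<Rightarrow> real^'n) \<Rightarrow> real^'n \<Rightarrow> real^'n" where
  "lie_bracket X Y x = frechet_derivative Y (at x) (X x) - frechet_derivative X (at x) (Y x)"

definition curvature_field :: "(real^'n \<Rightarrow> real^'n^'n) \<Rightarrow> (real^'n \<Rightarrow> real^'n) \<Rightarrow>
    (real^'n \<Rightarrow> real^'n) \<Rightarrow> (real^'n \<Rightarrow> real^'n) \<Rightarrow> real^'n \<Rightarrow> real^'n" where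
  "curvature_field g X Y Z x =
     covd g X (covd g Y Z) x - covd g Y (covd g X Z) x - covd g (lie_bracket X Y) Z x"

text \<open>By tensoriality the value at a point may be computed with any extensions of the three
  vectors; the constant-component ones are used.\<close>

definition curvature :: "(real^'n \<Rightarrow> real^'n^'n) \<Rightarrow> real^'n \<Rightarrow> real^'n \<Rightarrow> real^'n \<Rightarrow> real^'n \<Rightarrow> real^'n" where
  "curvature g x X Y Z = curvature_field g (\<lambda>_. X) (\<lambda>_. Y) (\<lambda>_. Z) x"

definition ricci :: "(real^'n \<Rightarrow> real^'n^'n) \<Rightarrow> real^'n \<Rightarrow> real^'n \<Rightarrow> real^'n \<Rightarrow> real" where
  "ricci g x X Y = trace (matrix (\<lambda>Z. curvature g x Z X Y))"

text \<open>The operator determined by \<open>g(\<S>X, Y) = S(X, Y)\<close>: the index of \<open>S(X, \<cdot>)\<close> is raised.\<close>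

definition ricci_op :: "(real^'n \<Rightarrow> real^'n^'n) \<Rightarrow> real^'n \<Rightarrow> real^'n \<Rightarrow> real^'n" where
  "ricci_op g x X = matrix_inv (g x) *v (\<chi> j. ricci g x X (axis j 1))"

definition scalar_curv :: "(real^'n \<Rightarrow> real^'n^'n) \<Rightarrow> real^'n \<Rightarrow> real" where
  "scalar_curv g x = trace (matrix (ricci_op g x))"

definition ricci_sq :: "(real^'n \<Rightarrow> real^'n^'n) \<Rightarrow> real^'n \<Rightarrow> real^'n \<Rightarrow> real^'n \<Rightarrow> real" where
  "ricci_sq g x X Y = ricci g x (ricci_op g x X) Y"

definition wedge :: "(real^'n \<Rightarrow> real^'n \<Rightarrow> real) \<Rightarrow> real^'n \<Rightarrow> real^'n \<Rightarrow> real^'n \<Rightarrow> real^'n" where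
  "wedge A X Y Z = A Y Z *\<^sub>R X - A X Z *\<^sub>R Y"

definition weyl :: "(real^'n \<Rightarrow> real^'n^'n) \<Rightarrow> real^'n \<Rightarrow> real^'n \<Rightarrow> real^'n \<Rightarrow> real^'n \<Rightarrow> real^'n" where
  "weyl g x X Y Z = curvature g x X Y Z - (1 / (real CARD('n) - 2)) *\<^sub>R
     (wedge (bform (g x)) X (ricci_op g x Y) Z + wedge (bform (g x)) (ricci_op g x X) Y Z
      - (scalar_curv g x / (real CARD('n) - 1)) *\<^sub>R wedge (bform (g x)) X Y Z)"

type_synonym 'v endo_form = "'v \<Rightarrow> 'v \<Rightarrow> 'v \<Rightarrow> 'v"
type_synonym 'v tensor4 = "'v \<Rightarrow> 'v \<Rightarrow> 'v \<Rightarrow> 'v \<Rightarrow> real"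
type_synonym 'v tensor6 = "'v \<Rightarrow> 'v \<Rightarrow> 'v \<Rightarrow> 'v \<Rightarrow> 'v \<Rightarrow> 'v \<Rightarrow> real"

definition lower4 :: "real^'n^'n \<Rightarrow> (real^'n) endo_form \<Rightarrow> (real^'n) tensor4" where
  "lower4 A B X1 X2 X3 X4 = bform A (B X1 X2 X3) X4"

definition G_tensor :: "(real^'n \<Rightarrow> real^'n^'n) \<Rightarrow> real^'n \<Rightarrow> (real^'n) tensor4" where
  "G_tensor g x = lower4 (g x) (wedge (bform (g x)))"

definition R_tensor :: "(real^'n \<Rightarrow> real^'n^'n) \<Rightarrow> real^'n \<Rightarrow> (real^'n) tensor4" where
  "R_tensor g x = lower4 (g x) (curvature g x)"

definition C_tensor :: "(real^'n \<Rightarrow> real^'n^'n) \<Rightarrow> real^'n \<Rightarrow> (real^'n) tensor4" where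
  "C_tensor g x = lower4 (g x) (weyl g x)"

text \<open>\<open>dot B T\<close> is \<open>B \<cdot> T\<close> for the (0,4)-tensor with endomorphism form \<open>B\<close>.\<close>

definition dot :: "(real^'n) endo_form \<Rightarrow> (real^'n) tensor4 \<Rightarrow> (real^'n) tensor6" where
  "dot B T X1 X2 X3 X4 X Y =
     - T (B X Y X1) X2 X3 X4 - T X1 (B X Y X2) X3 X4
     - T X1 X2 (B X Y X3) X4 - T X1 X2 X3 (B X Y X4)"

definition tachibana :: "(real^'n \<Rightarrow> real^'n \<Rightarrow> real) \<Rightarrow> (real^'n) tensor4 \<Rightarrow> (real^'n) tensor6" where
  "tachibana A T X1 X2 X3 X4 X Y =
     - T (wedge A X Y X1) X2 X3 X4 - T X1 (wedge A X Y X2) X3 X4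
     - T X1 X2 (wedge A X Y X3) X4 - T X1 X2 X3 (wedge A X Y X4)"


section \<open>Manifolds, tensors and semi-Riemannian manifolds\<close>

type_synonym ('a, 'n) chart = "'a set \<times> ('a \<Rightarrow> real^'n)"

abbreviation chart_dom :: "('a, 'n::finite) chart \<Rightarrow> 'a set" where
  "chart_dom c \<equiv> fst c"

abbreviation chart_map :: "('a, 'n::finite) chart \<Rightarrow> 'a \<Rightarrow> real^'n" where
  "chart_map c \<equiv> snd c"

abbreviation chart_inv :: "('a, 'n::finite) chart \<Rightarrow> real^'n \<Rightarrow> 'a" where
  "chart_inv c \<equiv> inv_into (chart_dom c) (chart_map c)"

text \<open>A symmetric (0,2)-tensor field assigns to each chart its component matrix as a function
  of the coordinates of that chart.\<close>

type_synonym ('a, 'n) tensor_field2 = "('a, 'n) chart \<Rightarrow> real^'n \<Rightarrow> real^'n^'n"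

definition paracompact :: "'a topology \<Rightarrow> bool" where
  "paracompact T \<longleftrightarrow> (\<forall>\<U>. (\<forall>U\<in>\<U>. openin T U) \<and> \<Union>\<U> = topspace T \<longrightarrow>
     (\<exists>\<V>. (\<forall>V\<in>\<V>. openin T V) \<and> \<Union>\<V> = topspace T \<and>
          (\<forall>V\<in>\<V>. \<exists>U\<in>\<U>. V \<subseteq> U) \<and> locally_finite_in T \<V>))"

definition smooth_atlas :: "'a topology \<Rightarrow> ('a, 'n::finite) chart set \<Rightarrow> bool" where
  "smooth_atlas T \<A> \<longleftrightarrow>
     (\<Union>c\<in>\<A>. chart_dom c) = topspace T \<and>
     (\<forall>c\<in>\<A>. openin T (chart_dom c) \<and> open (chart_map c ` chart_dom c) \<and>
        homeomorphic_map (subtopology T (chart_dom c))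
          (top_of_set (chart_map c ` chart_dom c)) (chart_map c)) \<and>
     (\<forall>c\<in>\<A>. \<forall>d\<in>\<A>. smooth_on (chart_map d \<circ> chart_inv c)
        (chart_map c ` (chart_dom c \<inter> chart_dom d)))"

definition smooth_manifold :: "'a topology \<Rightarrow> ('a, 'n::finite) chart set \<Rightarrow> bool" where
  "smooth_manifold T \<A> \<longleftrightarrow>
     Hausdorff_space T \<and> connected_space T \<and> paracompact T \<and> smooth_atlas T \<A>"

definition sym_tensor_field :: "('a, 'n::finite) chart set \<Rightarrow> ('a, 'n) tensor_field2 \<Rightarrow> bool" where
  "sym_tensor_field \<A> A \<longleftrightarrow>
     (\<forall>c\<in>\<A>. smooth_on (A c) (chart_map c ` chart_dom c) \<and>
        (\<forall>x\<in>chart_map c ` chart_dom c. transpose (A c x) = A c x)) \<and>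
     (\<forall>c\<in>\<A>. \<forall>d\<in>\<A>. \<forall>x\<in>chart_map c ` (chart_dom c \<inter> chart_dom d).
        let \<tau> = chart_map d \<circ> chart_inv c; D = frechet_derivative \<tau> (at x)
        in \<forall>X Y. bform (A c x) X Y = bform (A d (\<tau> x)) (D X) (D Y))"

record ('a, 'n) semi_riemannian =
  topology :: "'a topology"
  charts :: "('a, 'n::finite) chart set"
  metric :: "('a, 'n) tensor_field2"

definition semi_riemannian_manifold :: "('a, 'n::finite) semi_riemannian \<Rightarrow> bool" where
  "semi_riemannian_manifold M \<longleftrightarrow>
     smooth_manifold (topology M) (charts M) \<and>
     sym_tensor_field (charts M) (metric M) \<and>
     (\<forall>c\<in>charts M. \<forall>x\<in>chart_map c ` chart_dom c. invertible (metric M c x))"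

text \<open>Signature \<open>(s, t)\<close>: there is an orthonormal basis with \<open>s\<close> vectors of square \<open>-1\<close> and \<open>t\<close> of
  square \<open>1\<close>.\<close>

definition signature :: "real^'n^'n \<Rightarrow> nat \<Rightarrow> nat \<Rightarrow> bool" where
  "signature A s t \<longleftrightarrow> (\<exists>(e::'n \<Rightarrow> real^'n) \<sigma>.
     (\<forall>i. \<sigma> i \<in> {-1, 1}) \<and> card {i. \<sigma> i = -1} = s \<and> card {i. \<sigma> i = 1} = t \<and>
     (\<forall>i j. bform A (e i) (e j) = (if i = j then \<sigma> i else (0::real))))"

definition has_signature :: "('a, 'n::finite) semi_riemannian \<Rightarrow> nat \<Rightarrow> nat \<Rightarrow> bool" where
  "has_signature M s t \<longleftrightarrow>
     (\<forall>c\<in>charts M. \<forall>x\<in>chart_map c ` chart_dom c. signature (metric M c x) s t)"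

definition constant_curvature :: "('a, 'n::finite) semi_riemannian \<Rightarrow> real \<Rightarrow> bool" where
  "constant_curvature M k \<longleftrightarrow>
     (\<forall>c\<in>charts M. \<forall>x\<in>chart_map c ` chart_dom c. \<forall>X1 X2 X3 X4.
        R_tensor (metric M c) x X1 X2 X3 X4 = k * G_tensor (metric M c) x X1 X2 X3 X4)"

definition has_scalar_curvature :: "('a, 'n::finite) semi_riemannian \<Rightarrow> real \<Rightarrow> bool" where
  "has_scalar_curvature M k \<longleftrightarrow>
     (\<forall>c\<in>charts M. \<forall>x\<in>chart_map c ` chart_dom c. scalar_curv (metric M c) x = k)"


section \<open>Isometric immersions and hypersurfaces\<close>

definition local_rep :: "('a, 'n::finite) chart \<Rightarrow> ('b, 'k::finite) chart \<Rightarrow> ('a \<Rightarrow> 'b) \<Rightarrow>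
    real^'n \<Rightarrow> real^'k" where
  "local_rep c d f = chart_map d \<circ> f \<circ> chart_inv c"

definition local_dom :: "('a, 'n::finite) chart \<Rightarrow> ('b, 'k::finite) chart \<Rightarrow> ('a \<Rightarrow> 'b) \<Rightarrow>
    (real^'n) set" where
  "local_dom c d f = chart_map c ` (chart_dom c \<inter> f -` chart_dom d)"

definition isometric_immersion :: "('a, 'n::finite) semi_riemannian \<Rightarrow>
    ('b, 'k::finite) semi_riemannian \<Rightarrow> ('a \<Rightarrow> 'b) \<Rightarrow> bool" where
  "isometric_immersion M N f \<longleftrightarrow>
     continuous_map (topology M) (topology N) f \<and>
     (\<forall>c\<in>charts M. \<forall>d\<in>charts N.
        smooth_on (local_rep c d f) (local_dom c d f) \<and>
        (\<forall>x\<in>local_dom c d f.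
           let D = frechet_derivative (local_rep c d f) (at x)
           in inj D \<and>
              (\<forall>X Y. bform (metric M c x) X Y
                     = bform (metric N d (local_rep c d f x)) (D X) (D Y))))"

text \<open>Derivative, in direction \<open>X\<close> at \<open>x\<close>, of a vector field \<open>V\<close> along the map \<open>F\<close> (components of
  \<open>V x\<close> taken at \<open>F x\<close>), for the Levi-Civita connection of the target metric \<open>h\<close>.\<close>

definition covd_along :: "(real^'k \<Rightarrow> real^'k^'k) \<Rightarrow> (real^'n \<Rightarrow> real^'k) \<Rightarrow> real^'n \<Rightarrow>
    (real^'n \<Rightarrow> real^'k) \<Rightarrow> real^'n \<Rightarrow> real^'k" where
  "covd_along h F X V x = frechet_derivative V (at x) X
     + christoffel h (F x) (frechet_derivative F (at x) X) (V x)"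

text \<open>\<open>H\<close> is the second fundamental tensor with respect to (smooth, local) unit normal fields \<open>\<xi>\<close>
  with \<open>g(\<xi>, \<xi>) = \<epsilon>\<close>: the last equation is the Gauss formula
  \<open>\<nabla>\<^sup>N\<^sub>X Y = \<nabla>\<^sub>X Y + \<epsilon> H(X, Y) \<xi>\<close>, stated for constant-component \<open>X, Y\<close>, which suffices since the
  difference of both sides is tensorial in \<open>X\<close> and \<open>Y\<close>.\<close>

definition second_fundamental_tensor :: "('a, 'n::finite) semi_riemannian \<Rightarrow>
    ('b, 'k::finite) semi_riemannian \<Rightarrow> ('a \<Rightarrow> 'b) \<Rightarrow> real \<Rightarrow> ('a, 'n) tensor_field2 \<Rightarrow> bool" where
  "second_fundamental_tensor M N f \<epsilon> H \<longleftrightarrow>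
     sym_tensor_field (charts M) H \<and>
     (\<forall>c\<in>charts M. \<forall>d\<in>charts N. \<forall>x0\<in>local_dom c d f.
        let F = local_rep c d f; g = metric M c; h = metric N d;
            D = (\<lambda>x. frechet_derivative F (at x))
        in \<exists>\<Omega> \<xi>. open \<Omega> \<and> x0 \<in> \<Omega> \<and> \<Omega> \<subseteq> local_dom c d f \<and> smooth_on \<xi> \<Omega> \<and>
          (\<forall>x\<in>\<Omega>. bform (h (F x)) (\<xi> x) (\<xi> x) = \<epsilon> \<and>
            (\<forall>X. bform (h (F x)) (\<xi> x) (D x X) = 0) \<and>
            (\<forall>X Y. covd_along h F X (\<lambda>z. D z Y) x
               = D x (covd g (\<lambda>_. X) (\<lambda>_. Y) x) + (\<epsilon> * bform (H c x) X Y) *\<^sub>R \<xi> x)))"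

text \<open>Components \<open>H\<^sup>2\<^sub>i\<^sub>j\<close>, \<open>H\<^sup>3\<^sub>i\<^sub>j\<close> and \<open>tr(H)\<close>, for component matrices \<open>g\<close> and \<open>H\<close> at a point.\<close>

definition tensor_sq :: "real^'n^'n \<Rightarrow> real^'n^'n \<Rightarrow> real^'n^'n" where
  "tensor_sq g H = H ** matrix_inv g ** H"

definition tensor_cube :: "real^'n^'n \<Rightarrow> real^'n^'n \<Rightarrow> real^'n^'n" where
  "tensor_cube g H = tensor_sq g H ** matrix_inv g ** H"

definition tensor_trace :: "real^'n^'n \<Rightarrow> real^'n^'n \<Rightarrow> real" where
  "tensor_trace g H = trace (matrix_inv g ** H)"

definition U_H :: "('a, 'n::finite) semi_riemannian \<Rightarrow> ('a, 'n) tensor_field2 \<Rightarrow> 'a set" where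
  "U_H M H = {p. \<exists>c\<in>charts M. p \<in> chart_dom c \<and>
     (let x = chart_map c p in
      \<nexists>a b. tensor_sq (metric M c x) (H c x) = a *\<^sub>R metric M c x + b *\<^sub>R H c x)}"

end

theory Submission
  imports Defs
begin

text \<open>
  The theorem is the Gauss equation followed by linear algebra at one point.

  The Gauss formula for the immersion is differentiated along the hypersurface. As third derivatives
  commute and the ambient connection is metric, this yields the Gauss equation (lemma
  \<open>gauss_equation\<close>): the derivative of the normal field enters through the Weingarten equation, and
  the ambient curvature restricts to \<open>c G\<close>. With the shape operator \<open>A\<close>, defined by
  \<open>g(A X, Y) = H(X, Y)\<close>, and \<open>P = tr(A) A - A\<^sup>2\<close>, contraction shows that the Ricci operator is
  \<open>\<epsilon> P + (n - 1) c\<close> (lemma \<open>ricci_eq\<close>).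

  In \<open>R \<cdot> C - C \<cdot> R\<close> the terms \<open>R \<cdot> R\<close> cancel, and \<open>R \<cdot> G = 0\<close> because curvature operators are
  skew. So \<open>(n - 2) (R \<cdot> C - C \<cdot> R)\<close> is \<open>W \<cdot> R - R \<cdot> K - \<kappa>/(n - 1) Q(g, R)\<close>, where \<open>W\<close> has the
  endomorphisms \<open>X \<and>\<^sub>g \<S>Y + \<S>X \<and>\<^sub>g Y\<close> and \<open>K\<close> is the (0,4)-tensor that belongs to \<open>W\<close>
  (lemma \<open>commutator_reduction\<close>).

  The hypothesis on \<open>H\<^sup>3\<close> says that \<open>A\<close> is a root of a cubic whose quadratic coefficient is its own
  trace, that is \<open>P A = - \<psi> A - \<rho>\<close>. This is why the result closes up: products of \<open>A\<close> and the Ricci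
  operator, and the square of the Ricci operator, are again combinations of \<open>1\<close>, \<open>A\<close> and \<open>P\<close>. Both
  sides of the claim thus become cubic polynomials in the values of three symmetric forms, those of
  \<open>1\<close>, \<open>A\<close> and \<open>P\<close>, and these polynomials coincide (lemma \<open>pseudosymmetry_identity_of_forms\<close>).
\<close>

section \<open>Smooth maps\<close>

lemma smooth_on_differentiable: "smooth_on f S \<Longrightarrow> x \<in> S \<Longrightarrow> f differentiable (at x)"
  unfolding smooth_on_def by (metis ck_on.simps(2))

lemma smooth_on_continuous: "smooth_on f S \<Longrightarrow> continuous_on S f"
  unfolding smooth_on_def by (metis ck_on.simps(1))

lemma smooth_on_directional_derivative:
  "smooth_on f S \<Longrightarrow> smooth_on (\<lambda>x. frechet_derivative f (at x) v) S"
  unfolding smooth_on_def by (metis ck_on.simps(2))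

lemma ck_on_subset: "ck_on k f S \<Longrightarrow> T \<subseteq> S \<Longrightarrow> ck_on k f T"
  by (induction k arbitrary: f) (auto intro: continuous_on_subset)

lemma smooth_on_subset: "smooth_on f S \<Longrightarrow> T \<subseteq> S \<Longrightarrow> smooth_on f T"
  using ck_on_subset unfolding smooth_on_def by blast

lemma frechet_derivative_inner_left:
  assumes "f differentiable (at x)"
  shows "frechet_derivative (\<lambda>z. f z \<bullet> b) (at x) v = frechet_derivative f (at x) v \<bullet> b"
  using has_derivative_inner_left[OF assms[unfolded frechet_derivative_works], of b]
  by (metis frechet_derivative_at)

lemma line_has_real_derivative:
  fixes f :: "'a::real_normed_vector \<Rightarrow> real"
  assumes "f differentiable (at (a + s *\<^sub>R v))"
  shows "((\<lambda>s. f (a + s *\<^sub>R v)) has_real_derivative frechet_derivative f (at (a + s *\<^sub>R v)) v) (at s)"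
proof -
  let ?D = "frechet_derivative f (at (a + s *\<^sub>R v))"
  have "(f has_derivative ?D) (at (a + s *\<^sub>R v))"
    using assms frechet_derivative_works by blast
  then have "((\<lambda>s. f (a + s *\<^sub>R v)) has_derivative (\<lambda>r. ?D (r *\<^sub>R v))) (at s)"
    by (rule has_derivative_compose[rotated]) (auto intro!: derivative_eq_intros)
  moreover have "(\<lambda>r. ?D (r *\<^sub>R v)) = (*) (?D v)"
    using linear_frechet_derivative[OF assms] by (auto simp: linear_scale)
  ultimately show ?thesis by (simp add: has_field_derivative_def)
qed

text \<open>The mean value theorem is applied first in direction \<open>v\<close>, to the increment of \<open>f\<close> along \<open>w\<close>, and
  then in direction \<open>w\<close>. The left-hand side is symmetric in \<open>v\<close> and \<open>w\<close>, which is what makes the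
  mixed derivatives agree.\<close>

lemma second_difference_eq_mixed_derivative:
  fixes f :: "'a::real_normed_vector \<Rightarrow> real"
  assumes t: "0 < t"
    and D: "\<And>s r. 0 \<le> s \<Longrightarrow> s \<le> t \<Longrightarrow> 0 \<le> r \<Longrightarrow> r \<le> t \<Longrightarrow> x + s *\<^sub>R v + r *\<^sub>R w \<in> S"
    and f: "\<And>z. z \<in> S \<Longrightarrow> f differentiable (at z)"
    and fv: "\<And>z. z \<in> S \<Longrightarrow> (\<lambda>z. frechet_derivative f (at z) v) differentiable (at z)"
  obtains s r where "0 < s" "s < t" "0 < r" "r < t"
    "f (x + t *\<^sub>R v + t *\<^sub>R w) - f (x + t *\<^sub>R v) - f (x + t *\<^sub>R w) + f x
      = t * t * frechet_derivative (\<lambda>z. frechet_derivative f (at z) v) (at (x + s *\<^sub>R v + r *\<^sub>R w)) w"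
proof -
  let ?fv = "\<lambda>z. frechet_derivative f (at z) v"
  let ?\<phi> = "\<lambda>s. f ((x + t *\<^sub>R w) + s *\<^sub>R v) - f (x + s *\<^sub>R v)"
  have "\<exists>s. 0 < s \<and> s < t \<and> ?\<phi> t - ?\<phi> 0
      = (t - 0) * (?fv ((x + t *\<^sub>R w) + s *\<^sub>R v) - ?fv (x + s *\<^sub>R v))"
  proof (rule MVT2[OF t], rule DERIV_diff; rule line_has_real_derivative, rule f)
    fix s assume "0 \<le> s" "s \<le> t"
    show "x + t *\<^sub>R w + s *\<^sub>R v \<in> S" "x + s *\<^sub>R v \<in> S"
      using D[of s t] D[of s 0] t \<open>0 \<le> s\<close> \<open>s \<le> t\<close> by (auto simp: algebra_simps)
  qed
  then obtain s where s: "0 < s" "s < t"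
    "?\<phi> t - ?\<phi> 0 = t * (?fv ((x + s *\<^sub>R v) + t *\<^sub>R w) - ?fv ((x + s *\<^sub>R v) + 0 *\<^sub>R w))"
    by (auto simp: algebra_simps)
  have "\<exists>r. 0 < r \<and> r < t \<and> ?fv ((x + s *\<^sub>R v) + t *\<^sub>R w) - ?fv ((x + s *\<^sub>R v) + 0 *\<^sub>R w)
      = (t - 0) * frechet_derivative ?fv (at ((x + s *\<^sub>R v) + r *\<^sub>R w)) w"
    using s D by (intro MVT2[OF t] line_has_real_derivative fv) auto
  then obtain r where "0 < r" "r < t" "?fv ((x + s *\<^sub>R v) + t *\<^sub>R w) - ?fv ((x + s *\<^sub>R v) + 0 *\<^sub>R w)
      = t * frechet_derivative ?fv (at ((x + s *\<^sub>R v) + r *\<^sub>R w)) w" by auto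
  with s show ?thesis by (intro that[of s r]) (auto simp: algebra_simps)
qed

text \<open>Divided by \<open>t * t\<close>, one and the same second difference is a value of either mixed derivative at
  points that tend to \<open>x\<close> with \<open>t\<close>; continuity of both derivatives does the rest.\<close>

lemma mixed_derivatives_commute_real:
  fixes f :: "'a::euclidean_space \<Rightarrow> real"
  assumes S: "open S" "x \<in> S"
    and f: "\<And>z. z \<in> S \<Longrightarrow> f differentiable (at z)"
    and f1: "\<And>u z. z \<in> S \<Longrightarrow> (\<lambda>z. frechet_derivative f (at z) u) differentiable (at z)"
    and f2: "\<And>u u'. continuous_on S (\<lambda>z. frechet_derivative (\<lambda>z. frechet_derivative f (at z) u) (at z) u')"
  shows "frechet_derivative (\<lambda>z. frechet_derivative f (at z) v) (at x) w
       = frechet_derivative (\<lambda>z. frechet_derivative f (at z) w) (at x) v"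
proof -
  let ?f2 = "\<lambda>u u' z. frechet_derivative (\<lambda>z. frechet_derivative f (at z) u) (at z) u'"
  have near: "\<exists>d>0. \<forall>z. dist z x < d \<longrightarrow> z \<in> S \<and> dist (?f2 u u' z) (?f2 u u' x) < e"
    if "0 < e" for e u u'
  proof -
    have "isCont (?f2 u u') x" using f2 S continuous_on_eq_continuous_at by blast
    then obtain d where "d > 0" "\<forall>z. dist z x < d \<longrightarrow> dist (?f2 u u' z) (?f2 u u' x) < e"
      using \<open>0 < e\<close> unfolding continuous_at_eps_delta by blast
    moreover obtain d' where "d' > 0" "\<forall>z. dist z x < d' \<longrightarrow> z \<in> S"
      using S open_dist by metis
    ultimately show ?thesis by (intro exI[of _ "min d d'"]) auto
  qed
  have "\<bar>?f2 v w x - ?f2 w v x\<bar> \<le> 0"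
  proof (rule field_le_epsilon)
    fix e :: real assume "0 < e"
    obtain d1 where d1: "d1 > 0" "\<forall>z. dist z x < d1 \<longrightarrow> z \<in> S \<and> dist (?f2 v w z) (?f2 v w x) < e / 2"
      using near[of "e/2" v w] \<open>0 < e\<close> by auto
    obtain d2 where d2: "d2 > 0" "\<forall>z. dist z x < d2 \<longrightarrow> z \<in> S \<and> dist (?f2 w v z) (?f2 w v x) < e / 2"
      using near[of "e/2" w v] \<open>0 < e\<close> by auto
    \<comment> \<open>Small enough for the parallelogram spanned by \<open>t *\<^sub>R v\<close> and \<open>t *\<^sub>R w\<close> at \<open>x\<close> to lie in both balls.\<close>
    define t where "t = min d1 d2 / (norm v + norm w + 1)"
    have pos: "norm v + norm w + 1 > 0" by (simp add: add_nonneg_pos)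
    have t: "t > 0" using d1 d2 pos by (simp add: t_def)
    have small: "dist (x + s *\<^sub>R v + r *\<^sub>R w) x < min d1 d2" if "0 \<le> s" "s \<le> t" "0 \<le> r" "r \<le> t" for s r
    proof -
      have "dist (x + s *\<^sub>R v + r *\<^sub>R w) x \<le> norm (s *\<^sub>R v) + norm (r *\<^sub>R w)"
        using norm_triangle_ineq[of "s *\<^sub>R v" "r *\<^sub>R w"] by (simp add: dist_norm add.assoc)
      also have "\<dots> \<le> t * norm v + t * norm w"
        using that by (auto intro!: add_mono mult_right_mono)
      also have "\<dots> < t * (norm v + norm w + 1)" using t by (simp add: algebra_simps)
      also have "\<dots> = min d1 d2" using pos by (simp add: t_def)
      finally show ?thesis .
    qed
    obtain s r where sr: "0 < s" "s < t" "0 < r" "r < t"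
      "f (x + t *\<^sub>R v + t *\<^sub>R w) - f (x + t *\<^sub>R v) - f (x + t *\<^sub>R w) + f x
        = t * t * ?f2 v w (x + s *\<^sub>R v + r *\<^sub>R w)"
      by (rule second_difference_eq_mixed_derivative[OF t, of x v w S f])
        (use small d1 f f1 in auto)
    obtain s' r' where sr': "0 < s'" "s' < t" "0 < r'" "r' < t"
      "f (x + t *\<^sub>R w + t *\<^sub>R v) - f (x + t *\<^sub>R w) - f (x + t *\<^sub>R v) + f x
        = t * t * ?f2 w v (x + s' *\<^sub>R w + r' *\<^sub>R v)"
    proof (rule second_difference_eq_mixed_derivative[OF t, of x w v S f])
      fix s r :: real assume "0 \<le> s" "s \<le> t" "0 \<le> r" "r \<le> t"
      then show "x + s *\<^sub>R w + r *\<^sub>R v \<in> S"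
        using small[of r s] d1 by (simp add: algebra_simps)
    qed (use f f1 in auto)
    have "f (x + t *\<^sub>R w + t *\<^sub>R v) = f (x + t *\<^sub>R v + t *\<^sub>R w)" by (simp add: algebra_simps)
    then have "t * t * ?f2 v w (x + s *\<^sub>R v + r *\<^sub>R w) = t * t * ?f2 w v (x + s' *\<^sub>R w + r' *\<^sub>R v)"
      using sr(5) sr'(5) by linarith
    then have "?f2 v w (x + s *\<^sub>R v + r *\<^sub>R w) = ?f2 w v (x + s' *\<^sub>R w + r' *\<^sub>R v)"
      using t by simp
    moreover have "dist (?f2 v w (x + s *\<^sub>R v + r *\<^sub>R w)) (?f2 v w x) < e / 2"
      using small[of s r] sr d1 by auto
    moreover have "dist (?f2 w v (x + s' *\<^sub>R w + r' *\<^sub>R v)) (?f2 w v x) < e / 2"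
      using small[of r' s'] sr' d2 by (auto simp: algebra_simps)
    ultimately show "\<bar>?f2 v w x - ?f2 w v x\<bar> \<le> 0 + e"
      unfolding dist_real_def by linarith
  qed
  then show ?thesis by simp
qed

lemma mixed_derivatives_commute:
  fixes f :: "'a::euclidean_space \<Rightarrow> 'b::euclidean_space"
  assumes S: "open S" "x \<in> S" and f: "smooth_on f S"
  shows "frechet_derivative (\<lambda>z. frechet_derivative f (at z) v) (at x) w
       = frechet_derivative (\<lambda>z. frechet_derivative f (at z) w) (at x) v"
proof (rule euclidean_eqI)
  fix b :: 'b assume "b \<in> Basis"
  let ?fb = "\<lambda>z. f z \<bullet> b"
  note d1 = smooth_on_differentiable[OF f]
  note f1 = smooth_on_directional_derivative[OF f]
  note d2 = smooth_on_differentiable[OF f1]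
  have 1: "frechet_derivative ?fb (at z) u = frechet_derivative f (at z) u \<bullet> b" if "z \<in> S" for z u
    by (rule frechet_derivative_inner_left[OF d1[OF that]])
  have h2: "((\<lambda>z. frechet_derivative ?fb (at z) u) has_derivative
      (\<lambda>u'. frechet_derivative (\<lambda>z. frechet_derivative f (at z) u) (at z) u' \<bullet> b)) (at z)"
    if "z \<in> S" for z u
  proof (rule has_derivative_transform_within_open[OF _ S(1) that])
    show "((\<lambda>z. frechet_derivative f (at z) u \<bullet> b) has_derivative
      (\<lambda>u'. frechet_derivative (\<lambda>z. frechet_derivative f (at z) u) (at z) u' \<bullet> b)) (at z)"
      using d2[OF that] by (intro has_derivative_inner_left) (simp add: frechet_derivative_works)
  qed (simp add: 1)
  have 2: "frechet_derivative (\<lambda>z. frechet_derivative ?fb (at z) u) (at z) u'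
      = frechet_derivative (\<lambda>z. frechet_derivative f (at z) u) (at z) u' \<bullet> b" if "z \<in> S" for z u u'
    using frechet_derivative_at[OF h2[OF that, of u]] by metis
  have "frechet_derivative (\<lambda>z. frechet_derivative ?fb (at z) v) (at x) w
       = frechet_derivative (\<lambda>z. frechet_derivative ?fb (at z) w) (at x) v"
  proof (rule mixed_derivatives_commute_real[OF S])
    show "?fb differentiable (at z)" if "z \<in> S" for z using d1[OF that] by (simp add: differentiable_inner)
    show "(\<lambda>z. frechet_derivative ?fb (at z) u) differentiable (at z)" if "z \<in> S" for u z
      using h2[OF that] differentiableI by blast
    show "continuous_on S (\<lambda>z. frechet_derivative (\<lambda>z. frechet_derivative ?fb (at z) u) (at z) u')" for u u'
      using smooth_on_continuous[OF smooth_on_directional_derivative[OF f1]]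
      by (subst continuous_on_cong[OF refl 2]) (auto intro!: continuous_intros)
  qed
  then show "frechet_derivative (\<lambda>z. frechet_derivative f (at z) v) (at x) w \<bullet> b
      = frechet_derivative (\<lambda>z. frechet_derivative f (at z) w) (at x) v \<bullet> b"
    using 2 S(2) by simp
qed

text \<open>A product rule for \<open>z \<mapsto> L z (a z)\<close> that asks only for the derivatives of \<open>z \<mapsto> L z v\<close> at fixed \<open>v\<close>:
  in finite dimension \<open>L z (a z)\<close> is a finite sum of the scalar products \<open>(a z \<bullet> i) *\<^sub>R L z i\<close>. It is
  applied to differentials, Christoffel symbols and metrics, whose arguments also move with the
  point.\<close>

lemma has_derivative_linear_family:
  fixes L :: "'x::real_normed_vector \<Rightarrow> 'a::euclidean_space \<Rightarrow> 'c::real_normed_vector"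
  assumes S: "open S" "x \<in> S" and lin: "\<And>z. z \<in> S \<Longrightarrow> linear (L z)"
    and L: "\<And>v. ((\<lambda>z. L z v) has_derivative L' v) (at x)" and a: "(a has_derivative a') (at x)"
  shows "((\<lambda>z. L z (a z)) has_derivative (\<lambda>u. L' (a x) u + L x (a' u))) (at x)"
proof -
  have expand: "L z v = (\<Sum>i\<in>Basis. (v \<bullet> i) *\<^sub>R L z i)" if "z \<in> S" for z v
    using linear_sum[OF lin[OF that], of "\<lambda>i. (v \<bullet> i) *\<^sub>R i" Basis] lin[OF that]
    by (simp add: euclidean_representation linear_scale)
  have 1: "((\<lambda>z. \<Sum>i\<in>Basis. (a z \<bullet> i) *\<^sub>R L z i) has_derivative
      (\<lambda>u. \<Sum>i\<in>Basis. (a x \<bullet> i) *\<^sub>R L' i u + (a' u \<bullet> i) *\<^sub>R L x i)) (at x)"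
    by (intro has_derivative_sum has_derivative_scaleR has_derivative_inner_left a L)
  have "((\<lambda>z. \<Sum>i\<in>Basis. (a x \<bullet> i) *\<^sub>R L z i) has_derivative
      (\<lambda>u. \<Sum>i\<in>Basis. (a x \<bullet> i) *\<^sub>R L' i u)) (at x)"
    by (intro has_derivative_sum has_derivative_scaleR_right L)
  then have "((\<lambda>z. L z (a x)) has_derivative (\<lambda>u. \<Sum>i\<in>Basis. (a x \<bullet> i) *\<^sub>R L' i u)) (at x)"
    by (rule has_derivative_transform_within_open[OF _ S]) (simp flip: expand)
  then have "L' (a x) = (\<lambda>u. \<Sum>i\<in>Basis. (a x \<bullet> i) *\<^sub>R L' i u)"
    using L has_derivative_unique by blast
  then have "(\<lambda>u. \<Sum>i\<in>Basis. (a x \<bullet> i) *\<^sub>R L' i u + (a' u \<bullet> i) *\<^sub>R L x i) = (\<lambda>u. L' (a x) u + L x (a' u))"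
    by (simp add: sum.distrib flip: expand[OF S(2)])
  with 1 have "((\<lambda>z. \<Sum>i\<in>Basis. (a z \<bullet> i) *\<^sub>R L z i) has_derivative
      (\<lambda>u. L' (a x) u + L x (a' u))) (at x)" by simp
  then show ?thesis
    by (rule has_derivative_transform_within_open[OF _ S]) (simp flip: expand)
qed

lemma has_derivative_bilinear_family:
  fixes B :: "'x::real_normed_vector \<Rightarrow> 'a::euclidean_space \<Rightarrow> 'b::euclidean_space \<Rightarrow> 'c::real_normed_vector"
  assumes S: "open S" "x \<in> S" and bil: "\<And>z. z \<in> S \<Longrightarrow> bilinear (B z)"
    and B: "\<And>v w. ((\<lambda>z. B z v w) has_derivative B' v w) (at x)"
    and a: "(a has_derivative a') (at x)" and b: "(b has_derivative b') (at x)"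
  shows "((\<lambda>z. B z (a z) (b z)) has_derivative
    (\<lambda>u. B' (a x) (b x) u + B x (a' u) (b x) + B x (a x) (b' u))) (at x)"
proof -
  have *: "((\<lambda>z. B z v (b z)) has_derivative (\<lambda>u. B' v (b x) u + B x v (b' u))) (at x)" for v
    by (rule has_derivative_linear_family[OF S _ B b]) (use bil in \<open>simp add: bilinear_def\<close>)
  have "((\<lambda>z. B z (a z) (b z)) has_derivative
      (\<lambda>u. (B' (a x) (b x) u + B x (a x) (b' u)) + B x (a' u) (b x))) (at x)"
    by (rule has_derivative_linear_family[where L = "\<lambda>z v. B z v (b z)", OF S _ * a])
      (use bil in \<open>simp add: bilinear_def\<close>)
  then show ?thesis by (simp add: algebra_simps)
qed

section \<open>Differentiability of inverse matrices\<close>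

lemma differentiable_prod:
  fixes f :: "'i \<Rightarrow> 'a::real_normed_vector \<Rightarrow> real"
  assumes "\<And>i. i \<in> I \<Longrightarrow> f i differentiable (at x)"
  shows "(\<lambda>z. \<Prod>i\<in>I. f i z) differentiable (at x)"
proof -
  have "\<forall>i\<in>I. \<exists>d. (f i has_derivative d) (at x)" using assms by (simp add: differentiable_def)
  then obtain d where "\<forall>i\<in>I. (f i has_derivative d i) (at x)" by metis
  then have "((\<lambda>z. \<Prod>i\<in>I. f i z) has_derivative
      (\<lambda>y. \<Sum>i\<in>I. d i y * (\<Prod>j\<in>I - {i}. f j x))) (at x)"
    by (intro has_derivative_prod) auto
  then show ?thesis by (rule differentiableI)
qed

lemma differentiable_det:
  fixes A :: "'a::real_normed_vector \<Rightarrow> real^'n^'n"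
  assumes "\<And>i j. (\<lambda>z. A z $ i $ j) differentiable (at x)"
  shows "(\<lambda>z. det (A z)) differentiable (at x)"
  unfolding det_def
  by (intro differentiable_sum differentiable_mult differentiable_const differentiable_prod assms ballI)
    (simp add: finite_permutations)

lemma differentiable_vec_lambda:
  fixes f :: "'n::finite \<Rightarrow> 'a::real_normed_vector \<Rightarrow> real"
  assumes "\<And>k. f k differentiable (at x)"
  shows "(\<lambda>z. \<chi> k. f k z) differentiable (at x)"
proof -
  have "(\<chi> k. f k z) = (\<Sum>k\<in>UNIV. f k z *\<^sub>R axis k 1)" for z
    by (simp add: vec_eq_iff axis_def if_distrib[of "\<lambda>t. _ * t"] cong: if_cong)
  then show ?thesis using assms by (auto intro!: differentiable_sum)
qed

lemma matrix_inv_inverse: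
  fixes A :: "real^'n^'n"
  assumes "invertible A"
  shows "A ** matrix_inv A = mat 1" "matrix_inv A ** A = mat 1"
  using someI_ex[OF assms[unfolded invertible_def]] by (simp_all add: matrix_inv_def)

lemma matrix_inv_mult_vec_cramer:
  fixes A :: "real^'n^'n"
  assumes "invertible A"
  shows "matrix_inv A *v w = (\<chi> k. det (\<chi> i j. if j = k then w $ i else A $ i $ j) / det A)"
proof -
  have "A *v (matrix_inv A *v w) = w"
    using assms by (simp add: matrix_vector_mul_assoc matrix_inv_inverse)
  moreover have "det A \<noteq> 0" using assms by (simp add: invertible_det_nz)
  ultimately show ?thesis using cramer by blast
qed

text \<open>Cramer's rule turns the inverse into a quotient of determinants, so that no calculus on the group
  of invertible matrices is involved.\<close>

lemma differentiable_matrix_inv_mult_vec: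
  fixes A :: "'a::real_normed_vector \<Rightarrow> real^'n^'n" and w :: "'a \<Rightarrow> real^'n"
  assumes S: "open S" "x \<in> S" and inv: "\<And>z. z \<in> S \<Longrightarrow> invertible (A z)"
    and A: "A differentiable (at x)" and w: "\<And>i. (\<lambda>z. w z $ i) differentiable (at x)"
  shows "(\<lambda>z. matrix_inv (A z) *v w z) differentiable (at x)"
proof -
  have nth: "(\<lambda>z. A z $ i $ j) differentiable (at x)" for i j
  proof -
    have "bounded_linear (\<lambda>B::real^'n^'n. B $ i $ j)"
      by (rule bounded_linear_compose[OF bounded_linear_vec_nth bounded_linear_vec_nth])
    then show ?thesis
      using A bounded_linear.has_derivative unfolding differentiable_def by blast
  qed
  have entry: "(\<lambda>z. (\<chi> i j. if j = k then w z $ i else A z $ i $ j) $ i $ j) differentiable (at x)" for k i j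
    using nth w by (cases "j = k") auto
  have "(\<lambda>z. \<chi> k. det (\<chi> i j. if j = k then w z $ i else A z $ i $ j) / det (A z)) differentiable (at x)"
    using inv[OF S(2)]
    by (intro differentiable_vec_lambda differentiable_divide differentiable_det nth entry)
      (simp add: invertible_det_nz)
  then obtain D where "((\<lambda>z. \<chi> k. det (\<chi> i j. if j = k then w z $ i else A z $ i $ j) / det (A z))
      has_derivative D) (at x)" by (auto simp: differentiable_def)
  then have "((\<lambda>z. matrix_inv (A z) *v w z) has_derivative D) (at x)"
    by (rule has_derivative_transform_within_open[OF _ S]) (simp add: matrix_inv_mult_vec_cramer inv)
  then show ?thesis by (rule differentiableI)
qed

section \<open>Metrics in one coordinate domain\<close>

lemma bilinear_bform: "bilinear (bform A)"
  unfolding bilinear_def bform_def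
  by (auto intro!: linearI simp: algebra_simps matrix_vector_mult_scaleR)

lemma linear_bform_matrix: "linear (\<lambda>A. bform A X Y)"
  by (auto intro!: linearI simp: bform_def algebra_simps matrix_vector_mult_add_rdistrib
      simp flip: scaleR_matrix_vector_assoc)

lemma has_derivative_bform:
  fixes B :: "'a::real_normed_vector \<Rightarrow> real^'n^'n"
  assumes "(B has_derivative B') F"
  shows "((\<lambda>z. bform (B z) X Y) has_derivative (\<lambda>u. bform (B' u) X Y)) F"
proof -
  have "bounded_linear (\<lambda>A::real^'n^'n. bform A X Y)"
    by (simp add: linear_bform_matrix flip: linear_conv_bounded_linear)
  from bounded_linear.has_derivative[OF this assms] show ?thesis .
qed

lemma differentiable_bform:
  "B differentiable F \<Longrightarrow> (\<lambda>z. bform (B z) X Y) differentiable F"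
  unfolding differentiable_def using has_derivative_bform by blast

lemma bform_symmetric: "transpose A = A \<Longrightarrow> bform A X Y = bform A Y X"
  by (metis bform_def dot_lmul_matrix inner_commute transpose_matrix_vector)

lemma vec_lambda_axis_inner:
  assumes "linear K"
  shows "(\<chi> l. K (axis l 1)) \<bullet> Z = K Z"
proof -
  have "K Z = K (\<Sum>l\<in>UNIV. (Z $ l) *\<^sub>R axis l 1)"
    by (simp add: basis_expansion flip: scalar_mult_eq_scaleR)
  also have "\<dots> = (\<Sum>l\<in>UNIV. Z $ l * K (axis l 1))"
    by (simp add: linear_sum[OF assms] linear_scale[OF assms])
  finally show ?thesis by (simp add: inner_vec_def mult.commute)
qed

text \<open>The data that the classical local formulas of semi-Riemannian geometry need: a nondegenerate
  metric in one coordinate domain.\<close>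

locale local_metric =
  fixes g :: "real^'n \<Rightarrow> real^'n^'n" and V :: "(real^'n) set"
  assumes open_domain: "open V" and smooth: "smooth_on g V"
    and metric_symmetric: "x \<in> V \<Longrightarrow> transpose (g x) = g x"
    and nondegenerate: "x \<in> V \<Longrightarrow> invertible (g x)"
begin

lemma metric_commute: "x \<in> V \<Longrightarrow> bform (g x) X Y = bform (g x) Y X"
  by (simp add: bform_symmetric metric_symmetric)

lemma metric_has_derivative:
  assumes "x \<in> V"
  shows "((\<lambda>z. bform (g z) X Y) has_derivative (\<lambda>u. bform (frechet_derivative g (at x) u) X Y)) (at x)"
  using smooth_on_differentiable[OF smooth assms]
  by (intro has_derivative_bform) (simp add: frechet_derivative_works)

lemma metric_deriv_eq:
  "x \<in> V \<Longrightarrow> metric_deriv g x u X Y = bform (frechet_derivative g (at x) u) X Y"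
  unfolding metric_deriv_def using frechet_derivative_at[OF metric_has_derivative] by metis

lemma metric_deriv_commute:
  assumes "x \<in> V"
  shows "metric_deriv g x u X Y = metric_deriv g x u Y X"
proof -
  have "((\<lambda>z. bform (g z) X Y) has_derivative (\<lambda>u. bform (frechet_derivative g (at x) u) Y X)) (at x)"
    by (rule has_derivative_transform_within_open[OF metric_has_derivative[OF assms] open_domain assms])
      (rule metric_commute)
  then show ?thesis
    using frechet_derivative_at metric_deriv_eq[OF assms] unfolding metric_deriv_def by metis
qed

lemma metric_deriv_linear:
  assumes "x \<in> V"
  shows "linear (\<lambda>u. metric_deriv g x u X Y)" "linear (\<lambda>X. metric_deriv g x u X Y)"
    "linear (\<lambda>Y. metric_deriv g x u X Y)"
proof -
  have "linear (frechet_derivative g (at x))"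
    by (rule linear_frechet_derivative[OF smooth_on_differentiable[OF smooth assms]])
  from linear_compose[OF this linear_bform_matrix]
  show "linear (\<lambda>u. metric_deriv g x u X Y)" by (simp add: metric_deriv_eq[OF assms] o_def)
  show "linear (\<lambda>X. metric_deriv g x u X Y)" "linear (\<lambda>Y. metric_deriv g x u X Y)"
    using bilinear_bform[of "frechet_derivative g (at x) u"]
    by (simp_all add: metric_deriv_eq[OF assms] bilinear_def)
qed

lemmas metric_deriv_add = metric_deriv_linear[THEN linear_add]
lemmas metric_deriv_scale = metric_deriv_linear[THEN linear_scale]

lemma bform_matrix_inv:
  assumes "x \<in> V"
  shows "bform (g x) (matrix_inv (g x) *v w) Y = w \<bullet> Y"
proof -
  have "bform (g x) (matrix_inv (g x) *v w) Y = Y \<bullet> (g x *v (matrix_inv (g x) *v w))"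
    using metric_commute[OF assms] by (metis bform_def)
  then show ?thesis
    by (simp add: matrix_vector_mul_assoc matrix_inv_inverse nondegenerate assms inner_commute)
qed

lemma metric_nondegenerate:
  assumes "x \<in> V" "\<And>Y. bform (g x) U Y = bform (g x) W Y"
  shows "U = W"
proof -
  have "Y \<bullet> (g x *v U) = Y \<bullet> (g x *v W)" for Y
    using assms by (metis bform_def metric_commute)
  then have "g x *v U = g x *v W" by (metis vector_eq_ldot)
  then have "matrix_inv (g x) *v (g x *v U) = matrix_inv (g x) *v (g x *v W)" by simp
  then show ?thesis by (simp add: matrix_vector_mul_assoc matrix_inv_inverse nondegenerate assms)
qed

text \<open>Symmetry and bilinearity of the Christoffel vector follow from this formula by nondegeneracy,
  compatibility of the connection with the metric by adding two instances of it.\<close>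

lemma koszul:
  assumes x: "x \<in> V"
  shows "bform (g x) (christoffel g x X Y) Z
    = (metric_deriv g x X Y Z + metric_deriv g x Y X Z - metric_deriv g x Z X Y) / 2"
proof -
  let ?K = "\<lambda>Z. (metric_deriv g x X Y Z + metric_deriv g x Y X Z - metric_deriv g x Z X Y) / 2"
  have lin: "linear ?K"
    by (auto intro!: linearI simp: metric_deriv_add[OF x] metric_deriv_scale[OF x] field_simps)
  show ?thesis unfolding christoffel_def bform_matrix_inv[OF x] by (rule vec_lambda_axis_inner[OF lin])
qed

lemma christoffel_commute: "x \<in> V \<Longrightarrow> christoffel g x X Y = christoffel g x Y X"
  by (rule metric_nondegenerate) (auto simp: koszul metric_deriv_commute[of x _ X Y])

lemma christoffel_bilinear:
  assumes x: "x \<in> V"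
  shows "bilinear (christoffel g x)"
proof -
  have right: "linear (christoffel g x X)" for X
  proof (rule linearI; rule metric_nondegenerate[OF x])
    fix a Y Y' W
    show "bform (g x) (christoffel g x X (Y + Y')) W
        = bform (g x) (christoffel g x X Y + christoffel g x X Y') W"
      by (simp add: koszul x bilinear_ladd[OF bilinear_bform] metric_deriv_add field_simps)
    show "bform (g x) (christoffel g x X (a *\<^sub>R Y)) W = bform (g x) (a *\<^sub>R christoffel g x X Y) W"
      by (simp add: koszul x bilinear_lmul[OF bilinear_bform] metric_deriv_scale field_simps)
  qed
  then have "linear (\<lambda>X. christoffel g x X Y)" for Y
    by (subst christoffel_commute[OF x])
  with right show ?thesis by (simp add: bilinear_def)
qed

lemma metric_compatible:
  assumes "x \<in> V"
  shows "metric_deriv g x u X Y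
    = bform (g x) (christoffel g x u X) Y + bform (g x) X (christoffel g x u Y)"
  using metric_commute[OF assms, of X] metric_deriv_commute[OF assms]
  by (simp add: koszul assms field_simps)

lemma christoffel_differentiable:
  assumes x: "x \<in> V"
  shows "(\<lambda>z. christoffel g z X Y) differentiable (at x)"
proof -
  have d: "(\<lambda>z. metric_deriv g z u X Y) differentiable (at x)" for u X Y
  proof -
    obtain D where "((\<lambda>z. bform (frechet_derivative g (at z) u) X Y) has_derivative D) (at x)"
      using differentiable_bform[OF smooth_on_differentiable[OF
            smooth_on_directional_derivative[OF smooth] x]]
      unfolding differentiable_def by blast
    then have "((\<lambda>z. metric_deriv g z u X Y) has_derivative D) (at x)"
      by (rule has_derivative_transform_within_open[OF _ open_domain x]) (simp add: metric_deriv_eq)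
    then show ?thesis by (rule differentiableI)
  qed
  show ?thesis unfolding christoffel_def
    by (rule differentiable_matrix_inv_mult_vec[OF open_domain x nondegenerate
          smooth_on_differentiable[OF smooth x]])
      (auto intro!: differentiable_divide differentiable_add differentiable_diff d)
qed

lemma covd_const:
  "covd g (\<lambda>_. X) (\<lambda>_. Y) x = christoffel g x X Y"
  by (simp add: covd_def)

text \<open>For constant-component fields the bracket term vanishes.\<close>

lemma curvature_eq:
  assumes x: "x \<in> V"
  shows "curvature g x X Y Z
    = frechet_derivative (\<lambda>z. christoffel g z Y Z) (at x) X + christoffel g x X (christoffel g x Y Z)
    - (frechet_derivative (\<lambda>z. christoffel g z X Z) (at x) Y + christoffel g x Y (christoffel g x X Z))"
  using bilinear_lzero[OF christoffel_bilinear[OF x]]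
  by (simp add: curvature_def curvature_field_def covd_def[abs_def] lie_bracket_def)

end

section \<open>The Gauss equation\<close>

text \<open>A hypersurface in coordinates: \<open>F\<close> is the immersion read in charts, \<open>\<xi>\<close> a unit normal field with
  \<open>h(\<xi>, \<xi>) = \<epsilon>\<close>, and \<open>H\<close> is defined through the Gauss formula.\<close>

locale local_hypersurface = M: local_metric g \<Omega> + N: local_metric h V
  for g :: "real^'n \<Rightarrow> real^'n^'n" and \<Omega> and h :: "real^'k \<Rightarrow> real^'k^'k" and V +
  fixes F :: "real^'n \<Rightarrow> real^'k" and \<xi> :: "real^'n \<Rightarrow> real^'k" and H :: "real^'n \<Rightarrow> real^'n^'n"
    and \<epsilon> :: real
  assumes F_smooth: "smooth_on F \<Omega>" and F_into: "x \<in> \<Omega> \<Longrightarrow> F x \<in> V"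
    and isometric: "x \<in> \<Omega> \<Longrightarrow> bform (g x) X Y
      = bform (h (F x)) (frechet_derivative F (at x) X) (frechet_derivative F (at x) Y)"
    and normal_smooth: "smooth_on \<xi> \<Omega>"
    and normal_unit: "x \<in> \<Omega> \<Longrightarrow> bform (h (F x)) (\<xi> x) (\<xi> x) = \<epsilon>" and sign: "\<epsilon> * \<epsilon> = 1"
    and normal_orthogonal: "x \<in> \<Omega> \<Longrightarrow> bform (h (F x)) (\<xi> x) (frechet_derivative F (at x) X) = 0"
    and H_smooth: "smooth_on H \<Omega>" and H_symmetric: "x \<in> \<Omega> \<Longrightarrow> transpose (H x) = H x"
    and gauss_formula: "x \<in> \<Omega> \<Longrightarrow> covd_along h F X (\<lambda>z. frechet_derivative F (at z) Y) x
      = frechet_derivative F (at x) (covd g (\<lambda>_. X) (\<lambda>_. Y) x) + (\<epsilon> * bform (H x) X Y) *\<^sub>R \<xi> x"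
begin

abbreviation dF :: "real^'n \<Rightarrow> real^'n \<Rightarrow> real^'k" where
  "dF x \<equiv> frechet_derivative F (at x)"

abbreviation ddF :: "real^'n \<Rightarrow> real^'n \<Rightarrow> real^'n \<Rightarrow> real^'k" where
  "ddF x X Y \<equiv> frechet_derivative (\<lambda>z. dF z Y) (at x) X"

lemma linear_dF: "x \<in> \<Omega> \<Longrightarrow> linear (dF x)"
  by (rule linear_frechet_derivative[OF smooth_on_differentiable[OF F_smooth]])

lemma F_has_derivative: "x \<in> \<Omega> \<Longrightarrow> (F has_derivative dF x) (at x)"
  using smooth_on_differentiable[OF F_smooth] frechet_derivative_works by blast

lemma dF_has_derivative: "x \<in> \<Omega> \<Longrightarrow> ((\<lambda>z. dF z Y) has_derivative (\<lambda>X. ddF x X Y)) (at x)"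
  using smooth_on_differentiable[OF smooth_on_directional_derivative[OF F_smooth]]
    frechet_derivative_works by blast

lemma ddF_eq:
  assumes "x \<in> \<Omega>"
  shows "ddF x X Y = dF x (christoffel g x X Y) + (\<epsilon> * bform (H x) X Y) *\<^sub>R \<xi> x
    - christoffel h (F x) (dF x X) (dF x Y)"
  using gauss_formula[OF assms, of X Y] by (simp add: covd_along_def M.covd_const algebra_simps)

lemma normal_has_derivative: "x \<in> \<Omega> \<Longrightarrow> (\<xi> has_derivative frechet_derivative \<xi> (at x)) (at x)"
  using smooth_on_differentiable[OF normal_smooth] frechet_derivative_works by blast

text \<open>The tangential part of the covariant derivative of \<open>\<xi>\<close>. Differentiating \<open>h(\<xi>, dF W) = 0\<close> along \<open>X\<close>
  moves the derivative onto \<open>dF W\<close>, whose normal component is \<open>\<epsilon> H(X, W) \<xi>\<close>; since \<open>h(\<xi>, \<xi>) = \<epsilon>\<close>,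
  the two signs cancel.\<close>

lemma weingarten:
  assumes x: "x \<in> \<Omega>"
  shows "bform (h (F x)) (frechet_derivative \<xi> (at x) X + christoffel h (F x) (dF x X) (\<xi> x)) (dF x W)
    = - bform (H x) X W"
proof -
  let ?y = "F x"
  have y: "?y \<in> V" by (rule F_into[OF x])
  note bil = bilinear_ladd[OF bilinear_bform] bilinear_radd[OF bilinear_bform] bilinear_rsub[OF bilinear_bform]
     bilinear_rmul[OF bilinear_bform] bilinear_rneg[OF bilinear_bform]
  have "((\<lambda>z. bform (h (F z)) U W) has_derivative
      (\<lambda>X. bform (frechet_derivative h (at ?y) (dF x X)) U W)) (at x)" for U W
    by (rule has_derivative_compose[OF F_has_derivative[OF x] N.metric_has_derivative[OF y]])
  from has_derivative_bilinear_family[OF M.open_domain x bilinear_bform this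
      normal_has_derivative[OF x] dF_has_derivative[OF x]]
  have "((\<lambda>z. bform (h (F z)) (\<xi> z) (dF z W)) has_derivative
      (\<lambda>X. metric_deriv h ?y (dF x X) (\<xi> x) (dF x W)
        + bform (h ?y) (frechet_derivative \<xi> (at x) X) (dF x W)
        + bform (h ?y) (\<xi> x) (ddF x X W))) (at x)"
    by (simp add: N.metric_deriv_eq[OF y])
  moreover have "((\<lambda>z. bform (h (F z)) (\<xi> z) (dF z W)) has_derivative (\<lambda>X. 0)) (at x)"
    by (rule has_derivative_transform_within_open[OF has_derivative_const M.open_domain x])
      (simp add: normal_orthogonal)
  ultimately have "metric_deriv h ?y (dF x X) (\<xi> x) (dF x W)
        + bform (h ?y) (frechet_derivative \<xi> (at x) X) (dF x W)
        + bform (h ?y) (\<xi> x) (ddF x X W) = 0"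
    by (metis (no_types, lifting) has_derivative_unique)
  moreover have "\<epsilon> * bform (H x) X W * \<epsilon> = bform (H x) X W"
    by (metis sign mult.commute mult.left_commute mult_1_right)
  ultimately show ?thesis
    using normal_unit[OF x]
    by (simp add: N.metric_compatible[OF y] ddF_eq[OF x] bil normal_orthogonal[OF x])
qed

text \<open>The Gauss formula for \<open>Y, Z\<close> is differentiated covariantly along \<open>X\<close> and antisymmetrized in
  \<open>X, Y\<close>. The third derivatives of \<open>F\<close> cancel, and second derivatives are eliminated by the Gauss
  formula itself. This leaves the ambient curvature on one side and the intrinsic curvature, a
  multiple of \<open>\<xi>\<close> and the covariant derivatives of \<open>\<xi>\<close> on the other. The
  coefficient \<open>r\<close> (the Codazzi part) is left unspecified because the Gauss equation only tests
  against tangent vectors, to which \<open>\<xi>\<close> is orthogonal.\<close>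

lemma gauss_equation_vector:
  assumes x: "x \<in> \<Omega>"
  shows "\<exists>r. curvature h (F x) (dF x X) (dF x Y) (dF x Z) = dF x (curvature g x X Y Z) + r *\<^sub>R \<xi> x
    + (\<epsilon> * bform (H x) Y Z) *\<^sub>R (frechet_derivative \<xi> (at x) X + christoffel h (F x) (dF x X) (\<xi> x))
    - (\<epsilon> * bform (H x) X Z) *\<^sub>R (frechet_derivative \<xi> (at x) Y + christoffel h (F x) (dF x Y) (\<xi> x))"
proof -
  let ?y = "F x"
  let ?\<Gamma>h = "christoffel h ?y" and ?\<Gamma> = "christoffel g x"
  let ?dh = "\<lambda>X Y Z. frechet_derivative (\<lambda>y. christoffel h y Y Z) (at ?y) X"
  let ?dg = "\<lambda>X Y Z. frechet_derivative (\<lambda>z. christoffel g z Y Z) (at x) X"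
  let ?dH = "\<lambda>X Y Z. frechet_derivative (\<lambda>z. bform (H z) Y Z) (at x) X"
  have y: "?y \<in> V" by (rule F_into[OF x])
  have lhs: "((\<lambda>z. ddF z Y Z + christoffel h (F z) (dF z Y) (dF z Z)) has_derivative
      (\<lambda>X. frechet_derivative (\<lambda>z. ddF z Y Z) (at x) X
        + (?dh (dF x X) (dF x Y) (dF x Z)
          + ?\<Gamma>h (ddF x X Y) (dF x Z) + ?\<Gamma>h (dF x Y) (ddF x X Z)))) (at x)" for Y Z
  proof (rule has_derivative_add)
    show "((\<lambda>z. ddF z Y Z) has_derivative frechet_derivative (\<lambda>z. ddF z Y Z) (at x)) (at x)"
      using smooth_on_differentiable[OF smooth_on_directional_derivative[OF
            smooth_on_directional_derivative[OF F_smooth]] x]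
      by (simp add: frechet_derivative_works)
    have "((\<lambda>y. christoffel h y U W) has_derivative
        frechet_derivative (\<lambda>y. christoffel h y U W) (at ?y)) (at ?y)" for U W
      using N.christoffel_differentiable[OF y] frechet_derivative_works by blast
    from has_derivative_compose[OF F_has_derivative[OF x] this]
    have *: "((\<lambda>z. christoffel h (F z) U W) has_derivative (\<lambda>X. ?dh (dF x X) U W)) (at x)" for U W .
    show "((\<lambda>z. christoffel h (F z) (dF z Y) (dF z Z)) has_derivative
        (\<lambda>X. ?dh (dF x X) (dF x Y) (dF x Z)
          + ?\<Gamma>h (ddF x X Y) (dF x Z) + ?\<Gamma>h (dF x Y) (ddF x X Z))) (at x)"
      by (rule has_derivative_bilinear_family[OF M.open_domain x _ *
            dF_has_derivative[OF x] dF_has_derivative[OF x]])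
        (rule N.christoffel_bilinear[OF F_into])
  qed
  have rhs: "((\<lambda>z. ddF z Y Z + christoffel h (F z) (dF z Y) (dF z Z)) has_derivative
      (\<lambda>X. (ddF x X (?\<Gamma> Y Z) + dF x (?dg X Y Z))
        + ((\<epsilon> * bform (H x) Y Z) *\<^sub>R frechet_derivative \<xi> (at x) X + (\<epsilon> * ?dH X Y Z) *\<^sub>R \<xi> x))) (at x)" for Y Z
  proof (rule has_derivative_transform_within_open[OF _ M.open_domain x])
    have "((\<lambda>z. christoffel g z Y Z) has_derivative (\<lambda>X. ?dg X Y Z)) (at x)"
      using M.christoffel_differentiable[OF x] frechet_derivative_works by blast
    note 1 = has_derivative_linear_family[OF M.open_domain x linear_dF dF_has_derivative[OF x] this]
    have "(\<lambda>z. bform (H z) Y Z) differentiable (at x)"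
      by (rule differentiable_bform[OF smooth_on_differentiable[OF H_smooth x]])
    then have "((\<lambda>z. bform (H z) Y Z) has_derivative (\<lambda>X. ?dH X Y Z)) (at x)"
      using frechet_derivative_works by blast
    note 2 = has_derivative_scaleR[OF has_derivative_mult_right[OF this] normal_has_derivative[OF x]]
    show "((\<lambda>z. dF z (christoffel g z Y Z) + (\<epsilon> * bform (H z) Y Z) *\<^sub>R \<xi> z) has_derivative
        (\<lambda>X. (ddF x X (?\<Gamma> Y Z) + dF x (?dg X Y Z))
        + ((\<epsilon> * bform (H x) Y Z) *\<^sub>R frechet_derivative \<xi> (at x) X + (\<epsilon> * ?dH X Y Z) *\<^sub>R \<xi> x))) (at x)"
      by (rule has_derivative_add[OF 1 2])
  qed (simp add: ddF_eq)
  \<comment> \<open>The Gauss formula holds on all of \<open>\<Omega>\<close>, so that both sides have the same derivative at \<open>x\<close>.\<close>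
  have E: "frechet_derivative (\<lambda>z. ddF z Y Z) (at x) X
        + (?dh (dF x X) (dF x Y) (dF x Z)
          + ?\<Gamma>h (ddF x X Y) (dF x Z) + ?\<Gamma>h (dF x Y) (ddF x X Z))
      = (ddF x X (?\<Gamma> Y Z) + dF x (?dg X Y Z))
        + ((\<epsilon> * bform (H x) Y Z) *\<^sub>R frechet_derivative \<xi> (at x) X + (\<epsilon> * ?dH X Y Z) *\<^sub>R \<xi> x)" for X Y Z
    by (rule fun_cong[OF has_derivative_unique[OF lhs rhs]])
  have third: "frechet_derivative (\<lambda>z. ddF z Y Z) (at x) X = frechet_derivative (\<lambda>z. ddF z X Z) (at x) Y"
    by (rule mixed_derivatives_commute[OF M.open_domain x smooth_on_directional_derivative[OF F_smooth]])
  have second: "ddF x X Y = ddF x Y X"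
    by (rule mixed_derivatives_commute[OF M.open_domain x F_smooth])
  note bil = bilinear_radd[OF N.christoffel_bilinear[OF y]] bilinear_rsub[OF N.christoffel_bilinear[OF y]]
    bilinear_rmul[OF N.christoffel_bilinear[OF y]]
  define r where "r = \<epsilon> * (?dH X Y Z - ?dH Y X Z + bform (H x) X (?\<Gamma> Y Z) - bform (H x) Y (?\<Gamma> X Z))"
  have "curvature h ?y (dF x X) (dF x Y) (dF x Z) = dF x (curvature g x X Y Z) + r *\<^sub>R \<xi> x
    + (\<epsilon> * bform (H x) Y Z) *\<^sub>R (frechet_derivative \<xi> (at x) X + ?\<Gamma>h (dF x X) (\<xi> x))
    - (\<epsilon> * bform (H x) X Z) *\<^sub>R (frechet_derivative \<xi> (at x) Y + ?\<Gamma>h (dF x Y) (\<xi> x))"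
    using arg_cong2[where f = "(-)", OF E[where X = X and Y = Y and Z = Z] E[where X = Y and Y = X and Z = Z]]
      third second
    unfolding N.curvature_eq[OF y] M.curvature_eq[OF x] r_def
    by (simp add: ddF_eq[OF x, where Y = Z] ddF_eq[OF x, where Y = "?\<Gamma> _ _"] bil linear_add[OF linear_dF[OF x]]
        linear_diff[OF linear_dF[OF x]] algebra_simps)
  then show ?thesis by blast
qed

theorem gauss_equation:
  assumes x: "x \<in> \<Omega>"
  shows "R_tensor g x X Y Z W = R_tensor h (F x) (dF x X) (dF x Y) (dF x Z) (dF x W)
    + \<epsilon> * (bform (H x) Y Z * bform (H x) X W - bform (H x) X Z * bform (H x) Y W)"
proof -
  note bil = bilinear_ladd[OF bilinear_bform] bilinear_lsub[OF bilinear_bform] bilinear_lmul[OF bilinear_bform]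
  obtain r where *: "curvature h (F x) (dF x X) (dF x Y) (dF x Z) = dF x (curvature g x X Y Z) + r *\<^sub>R \<xi> x
    + (\<epsilon> * bform (H x) Y Z) *\<^sub>R (frechet_derivative \<xi> (at x) X + christoffel h (F x) (dF x X) (\<xi> x))
    - (\<epsilon> * bform (H x) X Z) *\<^sub>R (frechet_derivative \<xi> (at x) Y + christoffel h (F x) (dF x Y) (\<xi> x))"
    using gauss_equation_vector[OF x] by blast
  show ?thesis
    unfolding R_tensor_def lower4_def * isometric[OF x] bilinear_ladd[OF bilinear_bform, of _ "_ + _"]
      bilinear_lsub[OF bilinear_bform] bilinear_lmul[OF bilinear_bform] weingarten[OF x]
    by (simp add: bil weingarten[OF x] normal_orthogonal[OF x] algebra_simps)
qed

end

section \<open>The multilinear identity\<close>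

text \<open>In the application \<open>h\<close> is the form of a self-adjoint operator \<open>A\<close>, \<open>p\<close> that of
  \<open>P = tr(A) A - A\<^sup>2\<close>, and \<open>S = \<epsilon> P + m\<close> is the Ricci operator. The cubic equation for \<open>A\<close> enters
  as \<open>P A = - \<psi> A - \<rho>\<close>, the hypothesis on \<open>p (A X) Y\<close>; those on \<open>h (S X) Y\<close> and \<open>s2\<close> are what it
  implies for \<open>A S\<close> and \<open>S\<^sup>2\<close>. Hence every power of \<open>A\<close> that occurs reduces to \<open>g\<close>, \<open>h\<close> and \<open>p\<close>, and
  with the values of these as independent symbols the identity is one of polynomials. The
  coefficient \<open>\<tau>\<close> is left open because \<open>Q(g, G) = 0\<close>.\<close>

lemma pseudosymmetry_identity_of_forms:
  fixes g h p s s2 :: "real^'n \<Rightarrow> real^'n \<Rightarrow> real" and A S :: "real^'n \<Rightarrow> real^'n"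
    and \<epsilon> c m \<psi> \<rho> \<tau> :: real
  assumes eps: "\<epsilon> * \<epsilon> = 1"
    and bil: "bilinear g" "bilinear h" "bilinear p"
    and sym: "\<And>X Y. g X Y = g Y X" "\<And>X Y. h X Y = h Y X" "\<And>X Y. p X Y = p Y X"
    and gA: "\<And>X Y. g (A X) Y = h X Y"
    and pA: "\<And>X Y. p (A X) Y = - (\<psi> * h X Y + \<rho> * g X Y)"
    and gS: "\<And>X Y. g (S X) Y = s X Y"
    and hS: "\<And>X Y. h (S X) Y = m * h X Y - \<epsilon> * (\<psi> * h X Y + \<rho> * g X Y)"
    and s: "\<And>X Y. s X Y = \<epsilon> * p X Y + m * g X Y"
    and s2: "\<And>X Y. s2 X Y = (2 * \<epsilon> * m - \<psi>) * p X Y + \<rho> * h X Y + \<tau> * g X Y"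
  defines "G \<equiv> \<lambda>X Y Z W. g Y Z * g X W - g X Z * g Y W"
  defines "R \<equiv> \<lambda>X Y Z W. \<epsilon> * (h Y Z * h X W - h X Z * h Y W) + c * G X Y Z W"
  defines "K \<equiv> \<lambda>X Y Z W. s Y Z * g X W - g X Z * s Y W + g Y Z * s X W - s X Z * g Y W"
  shows "dot (\<lambda>X Y Z. wedge g X (S Y) Z + wedge g (S X) Y Z) R X1 X2 X3 X4 X Y
      - dot (\<lambda>X Y Z. \<epsilon> *\<^sub>R (h Y Z *\<^sub>R A X - h X Z *\<^sub>R A Y) + c *\<^sub>R wedge g X Y Z) K X1 X2 X3 X4 X Y
      = tachibana s R X1 X2 X3 X4 X Y + (m - \<epsilon> * \<psi>) * tachibana g R X1 X2 X3 X4 X Y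
        + tachibana s2 G X1 X2 X3 X4 X Y + (\<epsilon> * \<psi> - 2 * m) * tachibana s G X1 X2 X3 X4 X Y"
proof -
  have eps': "\<epsilon> * (\<epsilon> * a) = a" for a using eps by (metis mult.assoc mult_1)
  note lin = bil[THEN bilinear_ladd] bil[THEN bilinear_lsub] bil[THEN bilinear_lmul]
    bil[THEN bilinear_radd] bil[THEN bilinear_rsub] bil[THEN bilinear_rmul]
  have right: "g Y (A X) = h Y X" "p Y (A X) = - (\<psi> * h Y X + \<rho> * g Y X)" "g Y (S X) = \<epsilon> * p Y X + m * g Y X"
    "h Y (S X) = m * h Y X - \<epsilon> * (\<psi> * h Y X + \<rho> * g Y X)" for X Y
    by (metis gA pA gS hS s sym)+
  note eval = gA pA gS hS right s s2
  \<comment> \<open>Both sides are evaluated on the six vectors and become polynomials in the values of \<open>g\<close>, \<open>h\<close>, \<open>p\<close> at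
    pairs of them; \<open>sym\<close> acts as an ordered rewrite rule that selects one of \<open>g X Y\<close>, \<open>g Y X\<close>.\<close>
  show ?thesis
    unfolding dot_def tachibana_def R_def G_def K_def wedge_def
    apply (simp only: lin eval real_scaleR_def)
    apply (simp add: sym algebra_simps eps eps')
    done
qed

section \<open>Curvature at one point of a hypersurface\<close>

lemma trace_matrix: "trace (matrix f) = (\<Sum>i\<in>UNIV. f (axis i 1) $ i)"
  by (simp add: trace_def matrix_def)

lemma sum_axis_components:
  fixes K :: "real^'n \<Rightarrow> real"
  assumes "linear K"
  shows "(\<Sum>i\<in>UNIV. K (axis i 1) * v $ i) = K v"
  using vec_lambda_axis_inner[OF assms, of v] by (simp add: inner_vec_def)

lemma trace_eq_sum_axis:
  fixes A :: "real^'n^'n"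
  shows "trace A = (\<Sum>i\<in>UNIV. (A *v axis i 1) $ i)"
  using trace_matrix[of "(*v) A"] by simp

definition shape_operator :: "real^'n^'n \<Rightarrow> real^'n^'n \<Rightarrow> real^'n \<Rightarrow> real^'n" where
  "shape_operator g H X = matrix_inv g *v (H *v X)"

lemma dot_combination_right:
  "dot B (\<lambda>X Y Z W. T X Y Z W - a * (K X Y Z W - b * G X Y Z W)) X1 X2 X3 X4 X Y
    = dot B T X1 X2 X3 X4 X Y - a * (dot B K X1 X2 X3 X4 X Y - b * dot B G X1 X2 X3 X4 X Y)"
  by (simp add: dot_def algebra_simps)

lemma dot_combination_left:
  assumes "\<And>X Y Z. linear (\<lambda>U. T U X Y Z)" "\<And>X Y Z. linear (\<lambda>U. T X U Y Z)"
    "\<And>X Y Z. linear (\<lambda>U. T X Y U Z)" "\<And>X Y Z. linear (\<lambda>U. T X Y Z U)"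
  shows "dot (\<lambda>X Y Z. B X Y Z - a *\<^sub>R (W X Y Z - b *\<^sub>R U X Y Z)) T X1 X2 X3 X4 X Y
    = dot B T X1 X2 X3 X4 X Y - a * (dot W T X1 X2 X3 X4 X Y - b * dot U T X1 X2 X3 X4 X Y)"
  unfolding dot_def assms[THEN linear_diff] assms[THEN linear_scale] by (simp add: algebra_simps)

lemma tachibana_eq_dot: "tachibana A T = dot (wedge A) T"
  by (simp add: tachibana_def dot_def fun_eq_iff)

lemma G_tensor_eq:
  "G_tensor g x X Y Z W = bform (g x) Y Z * bform (g x) X W - bform (g x) X Z * bform (g x) Y W"
  by (simp add: G_tensor_def lower4_def wedge_def bilinear_lsub[OF bilinear_bform]
      bilinear_lmul[OF bilinear_bform])

lemma bform_tensor_sq: "bform (tensor_sq g H) X Y = bform H X (shape_operator g H Y)"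
  by (simp add: bform_def tensor_sq_def shape_operator_def matrix_vector_mul_assoc matrix_mul_assoc)

lemma bform_tensor_cube:
  "bform (tensor_cube g H) X Y = bform H X (shape_operator g H (shape_operator g H Y))"
  by (simp add: bform_def tensor_cube_def tensor_sq_def shape_operator_def matrix_vector_mul_assoc
      matrix_mul_assoc)

text \<open>One point at which the curvature tensor has the form given by the Gauss equation of a hypersurface
  in a space of constant curvature \<open>c\<close>. In this setting the theorem is linear algebra in one tangent
  space.\<close>

locale gauss_type_curvature = local_metric g V
  for g :: "real^'n \<Rightarrow> real^'n^'n" and V +
  fixes x and H :: "real^'n^'n" and \<epsilon> c :: real
  assumes point: "x \<in> V" and H_sym: "transpose H = H" and sign: "\<epsilon> * \<epsilon> = 1"
    and gauss: "R_tensor g x X Y Z W = \<epsilon> * (bform H Y Z * bform H X W - bform H X Z * bform H Y W)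
      + c * G_tensor g x X Y Z W"
begin

abbreviation "gx \<equiv> bform (g x)"
abbreviation "h \<equiv> bform H"
abbreviation "A \<equiv> shape_operator (g x) H"
abbreviation "t \<equiv> tensor_trace (g x) H"
abbreviation "p \<equiv> \<lambda>X Y. t * h X Y - h (A X) Y"

lemmas lin = bilinear_ladd[OF bilinear_bform] bilinear_lsub[OF bilinear_bform] bilinear_lmul[OF bilinear_bform]
   bilinear_radd[OF bilinear_bform] bilinear_rsub[OF bilinear_bform] bilinear_rmul[OF bilinear_bform]

lemma h_commute: "h X Y = h Y X"
  by (rule bform_symmetric[OF H_sym])

lemma g_shape: "gx (A X) Y = h X Y"
  unfolding shape_operator_def bform_matrix_inv[OF point]
  using h_commute[of X Y] by (simp add: bform_def inner_commute)

lemma g_shape_right: "gx X (A Y) = h X Y"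
  by (metis g_shape h_commute metric_commute point)

lemma h_shape: "h (A X) Y = h X (A Y)"
  by (metis g_shape h_commute metric_commute point)

lemma linear_shape: "linear A"
  unfolding shape_operator_def
  by (auto intro!: linearI simp: algebra_simps matrix_vector_mult_scaleR)

lemma curvature_eq_shape:
  "curvature g x X Y Z = \<epsilon> *\<^sub>R (h Y Z *\<^sub>R A X - h X Z *\<^sub>R A Y) + c *\<^sub>R wedge gx X Y Z"
proof (rule metric_nondegenerate[OF point])
  fix W
  show "gx (curvature g x X Y Z) W = gx (\<epsilon> *\<^sub>R (h Y Z *\<^sub>R A X - h X Z *\<^sub>R A Y) + c *\<^sub>R wedge gx X Y Z) W"
    using gauss[of X Y Z W]
    by (simp add: R_tensor_def lower4_def G_tensor_eq wedge_def lin g_shape)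
qed

text \<open>Every summand of \<open>Z \<mapsto> R(Z, X) Y\<close> is a multiple of \<open>A\<close> or of the identity, or has the form
  \<open>Z \<mapsto> K(Z) v\<close> with trace \<open>K(v)\<close>.\<close>

lemma ricci_eq: "ricci g x X Y = \<epsilon> * p X Y + ((real CARD('n) - 1) * c) * gx X Y"
proof -
  have hl: "linear (\<lambda>Z. h Z Y)" and gl: "linear (\<lambda>Z. gx Z Y)"
    using bilinear_bform by (auto simp: bilinear_def)
  have tr: "(\<Sum>i\<in>UNIV. A (axis i 1) $ i) = t"
    by (simp add: tensor_trace_def trace_eq_sum_axis shape_operator_def matrix_vector_mul_assoc)
  have one: "(\<Sum>i\<in>UNIV. axis i (1::real) $ (i::'n)) = real CARD('n)"
    by (simp add: axis_def)
  have "ricci g x X Y = (\<Sum>i\<in>UNIV. \<epsilon> * (h X Y * A (axis i 1) $ i - h (axis i 1) Y * A X $ i)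
      + c * (gx X Y * (axis i 1 :: real^'n) $ i - gx (axis i 1) Y * X $ i))"
    by (simp add: ricci_def trace_matrix curvature_eq_shape wedge_def)
  also have "\<dots> = \<epsilon> * (h X Y * (\<Sum>i\<in>UNIV. A (axis i 1) $ i) - (\<Sum>i\<in>UNIV. h (axis i 1) Y * A X $ i))
      + c * (gx X Y * (\<Sum>i\<in>UNIV. (axis i 1 :: real^'n) $ i) - (\<Sum>i\<in>UNIV. gx (axis i 1) Y * X $ i))"
    by (simp only: sum.distrib sum_subtractf flip: sum_distrib_left)
  also have "\<dots> = \<epsilon> * p X Y + ((real CARD('n) - 1) * c) * gx X Y"
    unfolding tr one sum_axis_components[OF hl] sum_axis_components[OF gl]
    by (simp add: algebra_simps)
  finally show ?thesis .
qed

lemma p_bilinear: "bilinear p"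
  unfolding bilinear_def
  by (auto intro!: linearI simp: lin linear_add[OF linear_shape] linear_scale[OF linear_shape] algebra_simps)

lemma g_ricci_op: "gx (ricci_op g x X) Y = ricci g x X Y"
proof -
  have "linear (\<lambda>Y. ricci g x X Y)"
    unfolding ricci_eq by (auto intro!: linearI simp: lin algebra_simps)
  then show ?thesis
    by (simp add: ricci_op_def bform_matrix_inv[OF point] vec_lambda_axis_inner)
qed

lemma R_tensor_linear:
  "linear (\<lambda>U. R_tensor g x U X Y Z)" "linear (\<lambda>U. R_tensor g x X U Y Z)"
  "linear (\<lambda>U. R_tensor g x X Y U Z)" "linear (\<lambda>U. R_tensor g x X Y Z U)"
  unfolding gauss G_tensor_eq by (auto intro!: linearI simp: lin algebra_simps)

lemma curvature_skew: "gx (curvature g x X Y U) W = - gx U (curvature g x X Y W)"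
  by (simp add: curvature_eq_shape lin wedge_def g_shape g_shape_right h_commute[of _ U]
      metric_commute[OF point, of _ U] algebra_simps)

lemma dot_curvature_G: "dot (curvature g x) (G_tensor g x) X1 X2 X3 X4 X Y = 0"
  by (simp add: dot_def G_tensor_eq curvature_skew algebra_simps)

text \<open>The Weyl tensor differs from the curvature tensor by multiples of \<open>K\<close>, the Kulkarni-Nomizu product
  of \<open>g\<close> with the Ricci tensor, and of \<open>G\<close>. The term \<open>R \<cdot> R\<close> occurs in both \<open>R \<cdot> C\<close> and \<open>C \<cdot> R\<close> and drops out,
  and \<open>R \<cdot> G = 0\<close>, so the scalar curvature survives only in the multiple of \<open>Q(g, R)\<close>.\<close>

lemma commutator_reduction:
  fixes X1 X2 X3 X4 X Y :: "real^'n"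
  assumes "CARD('n) \<noteq> 2"
  defines "S \<equiv> ricci_op g x"
  defines "K \<equiv> \<lambda>X Y Z W. ricci g x Y Z * gx X W - gx X Z * ricci g x Y W
    + gx Y Z * ricci g x X W - ricci g x X Z * gx Y W"
  shows "(real CARD('n) - 2) * (dot (curvature g x) (C_tensor g x) X1 X2 X3 X4 X Y
      - dot (weyl g x) (R_tensor g x) X1 X2 X3 X4 X Y)
    = dot (\<lambda>X Y Z. wedge gx X (S Y) Z + wedge gx (S X) Y Z) (R_tensor g x) X1 X2 X3 X4 X Y
      - dot (curvature g x) K X1 X2 X3 X4 X Y
      - scalar_curv g x / (real CARD('n) - 1) * tachibana gx (R_tensor g x) X1 X2 X3 X4 X Y"
proof -
  define a where "a = 1 / (real CARD('n) - 2)"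
  have a: "(real CARD('n) - 2) * a = 1" using assms(1) by (simp add: a_def)
  let ?b = "scalar_curv g x / (real CARD('n) - 1)"
  have C: "C_tensor g x = (\<lambda>X Y Z W. R_tensor g x X Y Z W - a * (K X Y Z W - ?b * G_tensor g x X Y Z W))"
  proof (intro ext)
    fix X Y Z W
    have "gx X (S Y) = ricci g x Y X" for X Y
      unfolding S_def by (metis g_ricci_op metric_commute[OF point])
    moreover have "ricci g x X Y = ricci g x Y X" for X Y
      by (simp add: ricci_eq h_shape h_commute[of X] metric_commute[OF point, of X])
    ultimately show "C_tensor g x X Y Z W = R_tensor g x X Y Z W - a * (K X Y Z W - ?b * G_tensor g x X Y Z W)"
      by (simp add: C_tensor_def lower4_def weyl_def a_def R_tensor_def lin wedge_def G_tensor_eq K_def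
          g_ricci_op[folded S_def] flip: S_def)
  qed
  have W: "weyl g x = (\<lambda>X Y Z. curvature g x X Y Z
      - a *\<^sub>R ((wedge gx X (S Y) Z + wedge gx (S X) Y Z) - ?b *\<^sub>R wedge gx X Y Z))"
    by (simp add: weyl_def fun_eq_iff S_def a_def)
  have cancel: "(real CARD('n) - 2) * ((T - a * (u - ?b * 0)) - (T - a * (v - ?b * w))) = v - u - ?b * w"
    for T u v w
  proof -
    have "(real CARD('n) - 2) * ((T - a * (u - ?b * 0)) - (T - a * (v - ?b * w)))
      = ((real CARD('n) - 2) * a) * (v - u - ?b * w)" by (simp add: algebra_simps)
    then show ?thesis by (simp only: a mult_1)
  qed
  show ?thesis
    unfolding C W dot_combination_right dot_combination_left[OF R_tensor_linear] dot_curvature_G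
      tachibana_eq_dot by (rule cancel)
qed

text \<open>With \<open>A\<close> the shape operator and \<open>t\<close> its trace, the equation for \<open>H\<^sup>3\<close> is \<open>A\<^sup>3 = t A\<^sup>2 + \<psi> A + \<rho>\<close>. It
  supplies the product rules that the multilinear identity asks for.\<close>

theorem pseudosymmetry_identity:
  fixes X1 X2 X3 X4 X Y :: "real^'n"
  assumes n: "CARD('n) \<noteq> 2"
    and cube: "tensor_cube (g x) H = t *\<^sub>R tensor_sq (g x) H + \<psi> *\<^sub>R H + \<rho> *\<^sub>R g x"
  shows "(real CARD('n) - 2) * (dot (curvature g x) (C_tensor g x) X1 X2 X3 X4 X Y
      - dot (weyl g x) (R_tensor g x) X1 X2 X3 X4 X Y)
    = tachibana (ricci g x) (R_tensor g x) X1 X2 X3 X4 X Y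
      + ((real CARD('n) - 1) * c - scalar_curv g x / (real CARD('n) - 1) - \<epsilon> * \<psi>)
        * tachibana gx (R_tensor g x) X1 X2 X3 X4 X Y
      + tachibana (ricci_sq g x) (G_tensor g x) X1 X2 X3 X4 X Y
      + (\<epsilon> * \<psi> - 2 * ((real CARD('n) - 1) * c)) * tachibana (ricci g x) (G_tensor g x) X1 X2 X3 X4 X Y"
proof -
  let ?m = "(real CARD('n) - 1) * c"
  have h3: "h U (A (A W)) = t * h U (A W) + \<psi> * h U W + \<rho> * gx U W" for U W
    using arg_cong[OF cube, of "\<lambda>B. bform B U W"]
    by (simp add: linear_add[OF linear_bform_matrix] linear_scale[OF linear_bform_matrix]
        bform_tensor_cube bform_tensor_sq)
  have hS: "h (ricci_op g x U) W = ?m * h U W - \<epsilon> * (\<psi> * h U W + \<rho> * gx U W)" for U W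
  proof -
    have "h (ricci_op g x U) W = ricci g x U (A W)"
      by (metis g_shape_right g_ricci_op)
    then show ?thesis
      by (simp add: ricci_eq h_shape h3 g_shape_right algebra_simps)
  qed
  have s2: "ricci_sq g x U W = (2 * \<epsilon> * ?m - \<psi>) * p U W + \<rho> * h U W
      + (?m * ?m - t * \<rho>) * gx U W" for U W
  proof -
    have "h (A (ricci_op g x U)) W = ?m * h U (A W) - \<epsilon> * (\<psi> * h U (A W) + \<rho> * h U W)"
      by (simp add: h_shape hS g_shape_right)
    moreover have sign': "\<epsilon> * (\<epsilon> * a) = a" for a using sign by (metis mult.assoc mult_1)
    ultimately show ?thesis
      by (simp add: ricci_sq_def ricci_eq hS g_ricci_op h_shape g_shape_right sign' algebra_simps)
  qed
  have R: "R_tensor g x = (\<lambda>X Y Z W. \<epsilon> * (h Y Z * h X W - h X Z * h Y W)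
      + c * (gx Y Z * gx X W - gx X Z * gx Y W))"
    by (simp add: fun_eq_iff gauss G_tensor_eq)
  have G: "G_tensor g x = (\<lambda>X Y Z W. gx Y Z * gx X W - gx X Z * gx Y W)"
    by (simp add: fun_eq_iff G_tensor_eq)
  have Rc: "curvature g x = (\<lambda>X Y Z. \<epsilon> *\<^sub>R (h Y Z *\<^sub>R A X - h X Z *\<^sub>R A Y) + c *\<^sub>R wedge gx X Y Z)"
    by (simp add: fun_eq_iff curvature_eq_shape)
  have "p (A U) W = - (\<psi> * h U W + \<rho> * gx U W)" for U W
    by (simp add: h_shape h3)
  moreover have "p U W = p W U" for U W
    by (simp add: h_shape h_commute[of U])
  ultimately have "dot (\<lambda>X Y Z. wedge gx X (ricci_op g x Y) Z + wedge gx (ricci_op g x X) Y Z)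
        (R_tensor g x) X1 X2 X3 X4 X Y
      - dot (curvature g x) (\<lambda>X Y Z W. ricci g x Y Z * gx X W - gx X Z * ricci g x Y W
        + gx Y Z * ricci g x X W - ricci g x X Z * gx Y W) X1 X2 X3 X4 X Y
      = tachibana (ricci g x) (R_tensor g x) X1 X2 X3 X4 X Y
        + (?m - \<epsilon> * \<psi>) * tachibana gx (R_tensor g x) X1 X2 X3 X4 X Y
        + tachibana (ricci_sq g x) (G_tensor g x) X1 X2 X3 X4 X Y
        + (\<epsilon> * \<psi> - 2 * ?m) * tachibana (ricci g x) (G_tensor g x) X1 X2 X3 X4 X Y"
    unfolding R G Rc
    by (intro pseudosymmetry_identity_of_forms[where p = p, OF sign bilinear_bform bilinear_bform p_bilinear
          metric_commute[OF point] h_commute _ g_shape _ g_ricci_op hS ricci_eq s2])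
  then show ?thesis
    unfolding commutator_reduction[OF n] by (simp add: algebra_simps)
qed

end

section \<open>From manifolds to coordinates\<close>

lemma chart_inv_chart_map:
  assumes "smooth_atlas T \<A>" "c \<in> \<A>" "q \<in> chart_dom c"
  shows "chart_inv c (chart_map c q) = q"
proof -
  have hom: "homeomorphic_map (subtopology T (chart_dom c))
      (top_of_set (chart_map c ` chart_dom c)) (chart_map c)"
    and "openin T (chart_dom c)"
    using assms by (auto simp: smooth_atlas_def)
  then have "topspace (subtopology T (chart_dom c)) = chart_dom c"
    using openin_subset by (auto simp: topspace_subtopology)
  then have "inj_on (chart_map c) (chart_dom c)"
    using homeomorphic_imp_injective_map[OF hom] by simp
  then show ?thesis using assms(3) by (rule inv_into_f_f)
qed

lemma local_metric_chart:
  assumes "semi_riemannian_manifold M" "a \<in> charts M" "open \<Omega>" "\<Omega> \<subseteq> chart_map a ` chart_dom a"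
  shows "local_metric (metric M a) \<Omega>"
proof
  show "open \<Omega>" by fact
  have "sym_tensor_field (charts M) (metric M)"
    and inv: "\<forall>x\<in>chart_map a ` chart_dom a. invertible (metric M a x)"
    using assms(1,2) unfolding semi_riemannian_manifold_def by blast+
  then have smooth: "smooth_on (metric M a) (chart_map a ` chart_dom a)"
    and sym: "\<And>x. x \<in> chart_map a ` chart_dom a \<Longrightarrow> transpose (metric M a x) = metric M a x"
    using assms(2) unfolding sym_tensor_field_def by blast+
  show "smooth_on (metric M a) \<Omega>" by (rule smooth_on_subset[OF smooth assms(4)])
  show "transpose (metric M a x) = metric M a x" if "x \<in> \<Omega>" for x
    using sym assms(4) that by blast
  show "invertible (metric M a x)" if "x \<in> \<Omega>" for x
    using inv assms(4) that by blast
qed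

text \<open>Around any point the immersion can be read in charts, and shrinking the domain to one that carries
  a normal field gives the local situation.\<close>

lemma local_hypersurface_at_point:
  assumes M: "semi_riemannian_manifold M" and N: "semi_riemannian_manifold N"
    and f: "isometric_immersion M N f" and eps: "\<epsilon> \<in> {-1, 1}"
    and H: "second_fundamental_tensor M N f \<epsilon> H"
    and a: "a \<in> charts M" and p: "p \<in> chart_dom a"
  obtains \<Omega> d \<xi> where "d \<in> charts N" "chart_map a p \<in> \<Omega>"
    "local_hypersurface (metric M a) \<Omega> (metric N d) (chart_map d ` chart_dom d)
      (local_rep a d f) \<xi> (H a) \<epsilon>"
proof -
  have atM: "smooth_atlas (topology M) (charts M)" and atN: "smooth_atlas (topology N) (charts N)"
    using M N unfolding semi_riemannian_manifold_def smooth_manifold_def by blast+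
  have "p \<in> topspace (topology M)"
    using atM a p unfolding smooth_atlas_def by blast
  then have "f p \<in> topspace (topology N)"
    using f unfolding isometric_immersion_def continuous_map_def by blast
  then obtain d where d: "d \<in> charts N" "f p \<in> chart_dom d"
    using atN unfolding smooth_atlas_def by blast
  let ?D = "local_dom a d f" and ?F = "local_rep a d f"
  have x: "chart_map a p \<in> ?D" using p d by (auto simp: local_dom_def)
  have D: "?D \<subseteq> chart_map a ` chart_dom a" by (auto simp: local_dom_def)
  have into: "?F z \<in> chart_map d ` chart_dom d" if "z \<in> ?D" for z
    using that chart_inv_chart_map[OF atM a] by (auto simp: local_dom_def local_rep_def)
  have F: "smooth_on ?F ?D"
    and iso: "\<And>z. z \<in> ?D \<Longrightarrow> \<forall>X Y. bform (metric M a z) X Y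
      = bform (metric N d (?F z)) (frechet_derivative ?F (at z) X) (frechet_derivative ?F (at z) Y)"
    using f a d(1) unfolding isometric_immersion_def Let_def by blast+
  have "sym_tensor_field (charts M) H"
    using H unfolding second_fundamental_tensor_def by blast
  then have H_smooth: "smooth_on (H a) (chart_map a ` chart_dom a)"
    and H_sym: "\<And>z. z \<in> chart_map a ` chart_dom a \<Longrightarrow> transpose (H a z) = H a z"
    using a unfolding sym_tensor_field_def by blast+
  have V: "open (chart_map d ` chart_dom d)"
    using atN d(1) unfolding smooth_atlas_def by blast
  obtain \<Omega> \<xi> where \<Omega>: "open \<Omega>" "chart_map a p \<in> \<Omega>" "\<Omega> \<subseteq> ?D" "smooth_on \<xi> \<Omega>"
    and \<xi>: "\<And>z. z \<in> \<Omega> \<Longrightarrow> bform (metric N d (?F z)) (\<xi> z) (\<xi> z) = \<epsilon>"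
    "\<And>z X. z \<in> \<Omega> \<Longrightarrow> bform (metric N d (?F z)) (\<xi> z) (frechet_derivative ?F (at z) X) = 0"
    "\<And>z X Y. z \<in> \<Omega> \<Longrightarrow> covd_along (metric N d) ?F X (\<lambda>z. frechet_derivative ?F (at z) Y) z
      = frechet_derivative ?F (at z) (covd (metric M a) (\<lambda>_. X) (\<lambda>_. Y) z)
        + (\<epsilon> * bform (H a z) X Y) *\<^sub>R \<xi> z"
  proof -
    have "\<exists>\<Omega> \<xi>. open \<Omega> \<and> chart_map a p \<in> \<Omega> \<and> \<Omega> \<subseteq> ?D \<and> smooth_on \<xi> \<Omega> \<and>
          (\<forall>z\<in>\<Omega>. bform (metric N d (?F z)) (\<xi> z) (\<xi> z) = \<epsilon> \<and>
            (\<forall>X. bform (metric N d (?F z)) (\<xi> z) (frechet_derivative ?F (at z) X) = 0) \<and>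
            (\<forall>X Y. covd_along (metric N d) ?F X (\<lambda>z. frechet_derivative ?F (at z) Y) z
              = frechet_derivative ?F (at z) (covd (metric M a) (\<lambda>_. X) (\<lambda>_. Y) z)
                + (\<epsilon> * bform (H a z) X Y) *\<^sub>R \<xi> z))"
      using H[unfolded second_fundamental_tensor_def Let_def, THEN conjunct2] a d(1) x by blast
    then obtain \<Omega> \<xi> where "open \<Omega>" "chart_map a p \<in> \<Omega>" "\<Omega> \<subseteq> ?D" "smooth_on \<xi> \<Omega>"
      and *: "\<forall>z\<in>\<Omega>. bform (metric N d (?F z)) (\<xi> z) (\<xi> z) = \<epsilon> \<and>
            (\<forall>X. bform (metric N d (?F z)) (\<xi> z) (frechet_derivative ?F (at z) X) = 0) \<and>
            (\<forall>X Y. covd_along (metric N d) ?F X (\<lambda>z. frechet_derivative ?F (at z) Y) z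
              = frechet_derivative ?F (at z) (covd (metric M a) (\<lambda>_. X) (\<lambda>_. Y) z)
                + (\<epsilon> * bform (H a z) X Y) *\<^sub>R \<xi> z)"
      by (elim exE conjE)
    then show ?thesis by (intro that[of \<Omega> \<xi>]) auto
  qed
  have "local_hypersurface (metric M a) \<Omega> (metric N d) (chart_map d ` chart_dom d) ?F \<xi> (H a) \<epsilon>"
  proof (intro local_hypersurface.intro local_hypersurface_axioms.intro)
    show "local_metric (metric M a) \<Omega>"
      using local_metric_chart[OF M a \<Omega>(1)] \<Omega>(3) D by blast
    show "local_metric (metric N d) (chart_map d ` chart_dom d)"
      by (rule local_metric_chart[OF N d(1) V order_refl])
    show "smooth_on ?F \<Omega>" by (rule smooth_on_subset[OF F \<Omega>(3)])
    show "smooth_on (H a) \<Omega>"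
      by (rule smooth_on_subset[OF H_smooth order_trans[OF \<Omega>(3) D]])
    show "transpose (H a z) = H a z" if "z \<in> \<Omega>" for z
      using H_sym that \<Omega>(3) D by blast
    show "\<epsilon> * \<epsilon> = 1" using eps by auto
    show "?F z \<in> chart_map d ` chart_dom d" if "z \<in> \<Omega>" for z
      using into that \<Omega>(3) by blast
    show "bform (metric M a z) X Y = bform (metric N d (?F z))
        (frechet_derivative ?F (at z) X) (frechet_derivative ?F (at z) Y)" if "z \<in> \<Omega>" for z X Y
      using iso that \<Omega>(3) by blast
  qed (rule \<Omega> \<xi>; assumption)+
  with d(1) \<Omega>(2) show ?thesis by (rule that)
qed

theorem theorem8p3:
  fixes M :: "('a, 'n::finite) semi_riemannian"
    and N :: "('b, 'k::finite) semi_riemannian"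
    and f :: "'a \<Rightarrow> 'b"
    and H :: "('a, 'n) tensor_field2"
    and s :: nat
    and c \<kappa>N \<epsilon> :: real
    and \<psi> \<rho> :: "'a \<Rightarrow> real"
  assumes "CARD('n) \<ge> 4" and "CARD('k) = CARD('n) + 1"
    and "semi_riemannian_manifold N"
    and "has_signature N s (CARD('n) + 1 - s)"
    and "constant_curvature N c"
    and "has_scalar_curvature N \<kappa>N"
    and "c = \<kappa>N / (real CARD('n) * (real CARD('n) + 1))"
    and "semi_riemannian_manifold M"
    and "isometric_immersion M N f"
    and "\<epsilon> \<in> {-1, 1}"
    and "second_fundamental_tensor M N f \<epsilon> H"
    and "\<forall>p\<in>U_H M H. \<forall>a\<in>charts M. p \<in> chart_dom a \<longrightarrow>
      (let x = chart_map a p; g = metric M a x; h = H a x in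
       tensor_cube g h = tensor_trace g h *\<^sub>R tensor_sq g h + \<psi> p *\<^sub>R h + \<rho> p *\<^sub>R g)"
  shows "\<forall>p\<in>U_H M H. \<forall>a\<in>charts M. p \<in> chart_dom a \<longrightarrow>
    (let n = real CARD('n); g = metric M a; x = chart_map a p;
         R = R_tensor g x; C = C_tensor g x; G = G_tensor g x; S = ricci g x in
     \<forall>X1 X2 X3 X4 X Y.
       (n - 2) * (dot (curvature g x) C X1 X2 X3 X4 X Y - dot (weyl g x) R X1 X2 X3 X4 X Y)
       = tachibana S R X1 X2 X3 X4 X Y
         + ((n - 1) * \<kappa>N / (n * (n + 1)) - scalar_curv g x / (n - 1) - \<epsilon> * \<psi> p)
           * tachibana (bform (g x)) R X1 X2 X3 X4 X Y
         + tachibana (ricci_sq g x) G X1 X2 X3 X4 X Y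
         + (\<epsilon> * \<psi> p - 2 * (n - 1) * \<kappa>N / (n * (n + 1)))
           * tachibana S G X1 X2 X3 X4 X Y)"
proof (intro ballI impI)
  fix p a assume p: "p \<in> U_H M H" and a: "a \<in> charts M" "p \<in> chart_dom a"
  let ?g = "metric M a" and ?x = "chart_map a p"
  obtain \<Omega> d \<xi> where d: "d \<in> charts N" and x: "?x \<in> \<Omega>"
    and hyp: "local_hypersurface ?g \<Omega> (metric N d) (chart_map d ` chart_dom d)
      (local_rep a d f) \<xi> (H a) \<epsilon>"
    by (rule local_hypersurface_at_point[OF assms(8,3,9,10,11) a])
  interpret local_hypersurface ?g \<Omega> "metric N d" "chart_map d ` chart_dom d"
    "local_rep a d f" \<xi> "H a" \<epsilon> by (rule hyp)
  interpret gauss_type_curvature ?g \<Omega> ?x "H a ?x" \<epsilon> c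
  proof
    fix X Y Z W
    have "R_tensor (metric N d) (local_rep a d f ?x) (dF ?x X) (dF ?x Y) (dF ?x Z) (dF ?x W)
        = c * G_tensor (metric N d) (local_rep a d f ?x) (dF ?x X) (dF ?x Y) (dF ?x Z) (dF ?x W)"
      using assms(5) d F_into[OF x] unfolding constant_curvature_def by blast
    then show "R_tensor ?g ?x X Y Z W
      = \<epsilon> * (bform (H a ?x) Y Z * bform (H a ?x) X W - bform (H a ?x) X Z * bform (H a ?x) Y W)
        + c * G_tensor ?g ?x X Y Z W"
      by (simp add: gauss_equation[OF x] G_tensor_eq isometric[OF x])
  qed (use x H_symmetric sign in auto)
  have cube: "tensor_cube (?g ?x) (H a ?x) = tensor_trace (?g ?x) (H a ?x) *\<^sub>R tensor_sq (?g ?x) (H a ?x)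
      + \<psi> p *\<^sub>R H a ?x + \<rho> p *\<^sub>R ?g ?x"
    using assms(12) p a by (auto simp: Let_def)
  have "(real CARD('n) - 1) * c = (real CARD('n) - 1) * \<kappa>N / (real CARD('n) * (real CARD('n) + 1))"
    "2 * ((real CARD('n) - 1) * c) = 2 * (real CARD('n) - 1) * \<kappa>N / (real CARD('n) * (real CARD('n) + 1))"
    by (simp_all add: assms(7))
  moreover have "CARD('n) \<noteq> 2" using assms(1) by simp
  note pseudosymmetry_identity[OF this cube]
  ultimately
  show "let n = real CARD('n); g = metric M a; x = chart_map a p;
         R = R_tensor g x; C = C_tensor g x; G = G_tensor g x; S = ricci g x in
     \<forall>X1 X2 X3 X4 X Y.
       (n - 2) * (dot (curvature g x) C X1 X2 X3 X4 X Y - dot (weyl g x) R X1 X2 X3 X4 X Y)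
       = tachibana S R X1 X2 X3 X4 X Y
         + ((n - 1) * \<kappa>N / (n * (n + 1)) - scalar_curv g x / (n - 1) - \<epsilon> * \<psi> p)
           * tachibana (bform (g x)) R X1 X2 X3 X4 X Y
         + tachibana (ricci_sq g x) G X1 X2 X3 X4 X Y
         + (\<epsilon> * \<psi> p - 2 * (n - 1) * \<kappa>N / (n * (n + 1)))
           * tachibana S G X1 X2 X3 X4 X Y"
    unfolding Let_def by metis
qed

end
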